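(* Let $\eta$ be an ergodic, locally square integrable stationary point process on $\mathbb{R}^d$ with intensity $\gamma\in(0,\infty)$ such that $\int(1+\|x\|^p)\,|\beta_2^!|(dx)<\infty$ for some $p>0$, and assume that $\eta$ is good. Let $n\in\mathbb{N}$, and let $k_1,\ldots,k_n\in\mathbb{R}^d\setminus\{0\}$ satisfy $\{k_i,-k_i\}\cap\{k_j,-k_j\}=\emptyset$ for $i\ne j$. Suppose that $N_j:(0,\infty)\to\mathbb{Z}^d$, $j\in\{1,\ldots,n\}$, satisfy $2\pi N_j(r)/r\to k_j$ as $r\to\infty$. Then $$\Big(\mathcal{S}_r\Big(\frac{2\pi}{r}N_1(r)\Big),\ldots,\mathcal{S}_r\Big(\frac{2\pi}{r}N_n(r)\Big)\Big)\overset{d}{\longrightarrow}(E_{k_1},\ldots,E_{k_n})\quad\text{as } r\to\infty,$$ where $E_{k_1},\ldots,E_{k_n}$ are independent and $E_{k_j}$ is exponentially distributed with mean $S(k_j)$ (with $E_{k_j}=0$ almost surely if $S(k_j)=0$).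
   Context: Let $d\ge1$. A (simple) point process $\eta$ on $\mathbb{R}^d$ is a random locally finite subset of $\mathbb{R}^d$ (with the $\sigma$-field generated by the counts $\eta(B):=\mathrm{card}(\eta\cap B)$, $B$ Borel). It is stationary if the distribution of $\eta+x$ does not depend on $x\in\mathbb{R}^d$; its intensity is $\gamma:=\mathbb{E}\,\eta([0,1]^d)$. It is locally square integrable if $\mathbb{E}\,\eta(B)^2<\infty$ for each bounded Borel set $B$. Ergodic means that the shift-invariant events have probability $0$ or $1$ under the distribution of $\eta$. The symbol $\overset{d}{\longrightarrow}$ denotes convergence in distribution. The reduced second factorial moment measure is $\alpha_2^!(\cdot):=\mathbb{E}\sum_{x,y\in\eta,\,x\ne y}\mathbf{1}\{x\in[0,1]^d,\ y-x\in\cdot\}$, and $\beta_2^!:=\alpha_2^!-\gamma^2\lambda_d$ (a signed measure defined on bounded Borel sets), where $\lambda_d$ is Lebesgue measure; $|\beta_2^!|$ is its total variation measure (defined on bounded Borel sets and extended by consistency). The structure factor is $S(k):=1+\frac1\gamma\int e^{-i\langle k,x\rangle}\,\beta_2^!(dx)$, $k\in\mathbb{R}^d$. Let $W_r:=[-r/2,r/2]^d$ for $r>0$. For $k\in\mathbb{R}^d$ put $$T_r(k):=\frac{1}{r^{d/2}}\sum_{x\in\eta\cap W_r}e^{-i\langle k,x\rangle}-\mathbf{1}\{k=0\}\gamma r^{d/2},$$ and define the scattering intensity $$\mathcal{S}_r(k):=\frac{1}{\eta(W_r)}\Big|\sum_{x\in\eta\cap W_r}e^{-i\langle k,x\rangle}-\mathbf{1}\{k=0\}\gamma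 r^d\Big|^2,\qquad 1/0:=0.$$ Let $Z_k$, $k\in\mathbb{R}^d\setminus\{0\}$, be independent centered complex-valued Gaussian random variables whose real and imaginary parts are independent with variance $\gamma S(k)/2$ each. The process $\eta$ is called good if for every $n\in\mathbb{N}$, every $k_1,\ldots,k_n\in\mathbb{R}^d\setminus\{0\}$ with $\{k_i,-k_i\}\cap\{k_j,-k_j\}=\emptyset$ for $i\neq j$, and all functions $N_j:(0,\infty)\to\mathbb{Z}^d$, $j=1,\ldots,n$, with $2\pi N_j(r)/r\to k_j$ as $r\to\infty$, one has $$\Big(T_r\big(\tfrac{2\pi}{r}N_1(r)\big),\ldots,T_r\big(\tfrac{2\pi}{r}N_n(r)\big)\Big)\overset{d}{\longrightarrow}(Z_{k_1},\ldots,Z_{k_n})\quad\text{as } r\to\infty.$$ *)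

theory Defs
  imports "HOL-Probability.Probability"
begin

section \<open>Point processes\<close>

definition loc_finite :: "(real ^ 'd) set \<Rightarrow> bool" where
  "loc_finite \<phi> \<longleftrightarrow> (\<forall>B. bounded B \<longrightarrow> finite (\<phi> \<inter> B))"

text \<open>Valued in \<^typ>\<open>ennreal\<close>, because the count of an unbounded set may be infinite.\<close>

definition points_in :: "(real ^ 'd) set \<Rightarrow> (real ^ 'd) set \<Rightarrow> ennreal" where
  "points_in \<phi> B = emeasure (count_space UNIV) (\<phi> \<inter> B)"

definition config_space :: "(real ^ 'd) set measure" where
  "config_space = sigma (Collect loc_finite)
     {{\<phi>. loc_finite \<phi> \<and> points_in \<phi> B \<in> C} | B C. B \<in> sets borel \<and> C \<in> sets borel}"

definition point_process :: "'w measure \<Rightarrow> ('w \<Rightarrow> (real ^ 'd) set) \<Rightarrow> bool" where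
  "point_process M \<eta> \<longleftrightarrow> prob_space M \<and> \<eta> \<in> measurable M config_space"

definition shift :: "real ^ 'd \<Rightarrow> (real ^ 'd) set \<Rightarrow> (real ^ 'd) set" where
  "shift x \<phi> = (\<lambda>y. y + x) ` \<phi>"

definition stationary :: "'w measure \<Rightarrow> ('w \<Rightarrow> (real ^ 'd) set) \<Rightarrow> bool" where
  "stationary M \<eta> \<longleftrightarrow>
     (\<forall>x x'. distr M config_space (\<lambda>\<omega>. shift x (\<eta> \<omega>)) =
             distr M config_space (\<lambda>\<omega>. shift x' (\<eta> \<omega>)))"

definition ergodic :: "'w measure \<Rightarrow> ('w \<Rightarrow> (real ^ 'd) set) \<Rightarrow> bool" where
  "ergodic M \<eta> \<longleftrightarrow>
     (\<forall>A \<in> sets config_space. (\<forall>x. shift x ` A = A) \<longrightarrow>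
        measure (distr M config_space \<eta>) A \<in> {0, 1})"

definition loc_square_integrable :: "'w measure \<Rightarrow> ('w \<Rightarrow> (real ^ 'd) set) \<Rightarrow> bool" where
  "loc_square_integrable M \<eta> \<longleftrightarrow>
     (\<forall>B \<in> sets borel. bounded B \<longrightarrow> (\<integral>\<^sup>+\<omega>. (points_in (\<eta> \<omega>) B)\<^sup>2 \<partial>M) < \<infinity>)"

definition unit_cube :: "(real ^ 'd) set" where
  "unit_cube = cbox (\<chi> i. 0) (\<chi> i. 1)"

definition intensity :: "'w measure \<Rightarrow> ('w \<Rightarrow> (real ^ 'd) set) \<Rightarrow> ennreal" where
  "intensity M \<eta> = (\<integral>\<^sup>+\<omega>. points_in (\<eta> \<omega>) unit_cube \<partial>M)"


section \<open>Second order measures and the structure factor\<close>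

definition red_fact_moment :: "'w measure \<Rightarrow> ('w \<Rightarrow> (real ^ 'd) set) \<Rightarrow> (real ^ 'd) set \<Rightarrow> ennreal" where
  "red_fact_moment M \<eta> B =
     (\<integral>\<^sup>+\<omega>. emeasure (count_space UNIV)
        {(x, y). x \<in> \<eta> \<omega> \<and> y \<in> \<eta> \<omega> \<and> x \<noteq> y \<and> x \<in> unit_cube \<and> y - x \<in> B} \<partial>M)"

text \<open>Only meaningful on bounded Borel sets, where both terms are finite.
  Here and below \<open>\<gamma>\<close> stands for the intensity as a real number.\<close>

definition beta2 :: "real \<Rightarrow> 'w measure \<Rightarrow> ('w \<Rightarrow> (real ^ 'd) set) \<Rightarrow> (real ^ 'd) set \<Rightarrow> real" where
  "beta2 \<gamma> M \<eta> B = enn2real (red_fact_moment M \<eta> B) - \<gamma>\<^sup>2 * measure lborel B"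

text \<open>Upper variation (positive Jordan part) of a signed measure \<open>\<nu>\<close> defined on bounded Borel
  sets. Taking the supremum over the bounded Borel subsets of an arbitrary Borel set \<open>B\<close>
  is also the consistent extension from bounded to arbitrary Borel sets; the result is countably
  additive whenever \<open>\<nu>\<close> is countably additive on the Borel subsets of each bounded set.
  The lower variation of \<open>\<nu>\<close> is the upper variation of \<open>-\<nu>\<close>.\<close>

definition upper_variation :: "((real ^ 'd) set \<Rightarrow> real) \<Rightarrow> (real ^ 'd) measure" where
  "upper_variation \<nu> = measure_of UNIV (sets borel)
     (\<lambda>B. SUP A \<in> {A \<in> sets borel. bounded A \<and> A \<subseteq> B}. ennreal (\<nu> A))"

definition lower_variation :: "((real ^ 'd) set \<Rightarrow> real) \<Rightarrow> (real ^ 'd) measure" where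
  "lower_variation \<nu> = upper_variation (\<lambda>A. - \<nu> A)"

definition total_variation :: "((real ^ 'd) set \<Rightarrow> real) \<Rightarrow> (real ^ 'd) measure" where
  "total_variation \<nu> = measure_of UNIV (sets borel)
     (\<lambda>B. emeasure (upper_variation \<nu>) B + emeasure (lower_variation \<nu>) B)"

definition signed_integral ::
  "((real ^ 'd) set \<Rightarrow> real) \<Rightarrow> (real ^ 'd \<Rightarrow> complex) \<Rightarrow> complex" where
  "signed_integral \<nu> f =
     integral\<^sup>L (upper_variation \<nu>) f - integral\<^sup>L (lower_variation \<nu>) f"

text \<open>Complex-valued as written; since \<^const>\<open>beta2\<close> is invariant under reflection at the origin for
  stationary processes, its values are real, and \<^const>\<open>Re\<close> is used where a real number is needed.\<close>

definition structure_factor ::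
  "real \<Rightarrow> 'w measure \<Rightarrow> ('w \<Rightarrow> (real ^ 'd) set) \<Rightarrow> real ^ 'd \<Rightarrow> complex" where
  "structure_factor \<gamma> M \<eta> k =
     1 + 1 / of_real \<gamma> * signed_integral (beta2 \<gamma> M \<eta>) (\<lambda>x. exp (- \<i> * of_real (k \<bullet> x)))"


section \<open>Scattering intensity\<close>

definition window :: "real \<Rightarrow> (real ^ 'd) set" where
  "window r = cbox (\<chi> i. - r / 2) (\<chi> i. r / 2)"

definition T_stat :: "real \<Rightarrow> real \<Rightarrow> (real ^ 'd) set \<Rightarrow> real ^ 'd \<Rightarrow> complex" where
  "T_stat \<gamma> r \<phi> k =
     1 / of_real (r powr (real CARD('d) / 2)) *
       (\<Sum>x \<in> \<phi> \<inter> window r. exp (- \<i> * of_real (k \<bullet> x)))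
     - (if k = 0 then of_real (\<gamma> * r powr (real CARD('d) / 2)) else 0)"

text \<open>The convention \<open>1/0 = 0\<close> is that of HOL.\<close>

definition scattering_intensity :: "real \<Rightarrow> real \<Rightarrow> (real ^ 'd) set \<Rightarrow> real ^ 'd \<Rightarrow> real" where
  "scattering_intensity \<gamma> r \<phi> k =
     1 / real (card (\<phi> \<inter> window r)) *
       (cmod ((\<Sum>x \<in> \<phi> \<inter> window r. exp (- \<i> * of_real (k \<bullet> x)))
              - (if k = 0 then of_real (\<gamma> * r ^ CARD('d)) else 0)))\<^sup>2"


section \<open>Convergence in distribution and limit laws\<close>

text \<open>Weak convergence of the laws of \<open>X r\<close> (random elements of \<open>topspace T\<close>) to the law \<open>L\<close>.\<close>

definition conv_in_distr ::
  "'w measure \<Rightarrow> 'b topology \<Rightarrow> ('r \<Rightarrow> 'w \<Rightarrow> 'b) \<Rightarrow> 'b measure \<Rightarrow> 'r filter \<Rightarrow> bool" where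
  "conv_in_distr M T X L F \<longleftrightarrow>
     (\<forall>f :: 'b \<Rightarrow> real. continuous_map T euclideanreal f \<and> bounded (f ` topspace T) \<longrightarrow>
        ((\<lambda>r. \<integral>\<omega>. f (X r \<omega>) \<partial>M) \<longlongrightarrow> (\<integral>y. f y \<partial>L)) F)"

text \<open>An \<open>n\<close>-tuple is an extensional function on \<open>{..<n}\<close>; the number \<open>n\<close> is quantified inside
  \<open>good\<close> below, so it cannot be a type. The limit is a vector of independent components with
  laws \<open>L j\<close>, i.e. its law is the product measure.\<close>

definition tuple_conv_in_distr ::
  "'w measure \<Rightarrow> nat \<Rightarrow> (nat \<Rightarrow> real \<Rightarrow> 'w \<Rightarrow> 'b::topological_space) \<Rightarrow> (nat \<Rightarrow> 'b measure) \<Rightarrow> bool" where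
  "tuple_conv_in_distr M n X L \<longleftrightarrow>
     conv_in_distr M (product_topology (\<lambda>_. euclidean) {..<n})
       (\<lambda>r \<omega>. \<lambda>j\<in>{..<n}. X j r \<omega>) (\<Pi>\<^sub>M j\<in>{..<n}. L j) at_top"

text \<open>Variance \<open>0\<close> and mean \<open>0\<close> give the point mass at \<open>0\<close> (as do negative parameters, which
  do not occur because the structure factor is nonnegative).\<close>

definition centered_gaussian :: "real \<Rightarrow> real measure" where
  "centered_gaussian v =
     (if v > 0 then density lborel (normal_density 0 (sqrt v)) else return borel 0)"

text \<open>The parameter is the variance of the real part and of the imaginary part.\<close>

definition complex_gaussian :: "real \<Rightarrow> complex measure" where
  "complex_gaussian v =
     distr (centered_gaussian v \<Otimes>\<^sub>M centered_gaussian v) borel (\<lambda>(a, b). Complex a b)"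

definition exponential_law :: "real \<Rightarrow> real measure" where
  "exponential_law m =
     (if m > 0 then density lborel (exponential_density (1 / m)) else return borel 0)"


section \<open>Good processes\<close>

definition lattice_freq :: "real \<Rightarrow> int ^ 'd \<Rightarrow> real ^ 'd" where
  "lattice_freq r z = (2 * pi / r) *\<^sub>R (\<chi> i. of_int (z $ i))"

text \<open>The values of \<open>N j\<close> on \<open>{..0}\<close> play no role.\<close>

definition admissible :: "nat \<Rightarrow> (nat \<Rightarrow> real ^ 'd) \<Rightarrow> (nat \<Rightarrow> real \<Rightarrow> int ^ 'd) \<Rightarrow> bool" where
  "admissible n k N \<longleftrightarrow>
     (\<forall>j<n. k j \<noteq> 0) \<and>
     (\<forall>i<n. \<forall>j<n. i \<noteq> j \<longrightarrow> {k i, - k i} \<inter> {k j, - k j} = {}) \<and>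
     (\<forall>j<n. ((\<lambda>r. lattice_freq r (N j r)) \<longlongrightarrow> k j) at_top)"

definition good :: "real \<Rightarrow> 'w measure \<Rightarrow> ('w \<Rightarrow> (real ^ 'd) set) \<Rightarrow> bool" where
  "good \<gamma> M \<eta> \<longleftrightarrow>
     (\<forall>n k N. admissible n k N \<longrightarrow>
        tuple_conv_in_distr M n
          (\<lambda>j r \<omega>. T_stat \<gamma> r (\<eta> \<omega>) (lattice_freq r (N j r)))
          (\<lambda>j. complex_gaussian (\<gamma> * Re (structure_factor \<gamma> M \<eta> (k j)) / 2)))"

end

theory Submission
  imports Defs
begin

text \<open>
  The scattering intensity is \<open>r\<^sup>d / \<eta>(W\<^sub>r)\<close> times the squared modulus of the statistic \<open>T\<^sub>r\<close>, also at
  frequency \<open>0\<close>. Goodness gives the joint limit of the \<open>T\<^sub>r\<close>, and the squared modulus of a centered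
  complex Gaussian variable is exponentially distributed, so by Slutsky's theorem it suffices that
  \<open>\<eta>(W\<^sub>r) / r\<^sup>d\<close> converges to \<open>\<gamma>\<close> in probability. By stationarity,
  the variance of \<open>\<eta>(W\<^sub>r)\<close> is at most \<open>r\<^sup>d\<close> times the sum of \<open>\<gamma>\<close> and the total mass
  of the positive part of \<open>\<beta>\<^sub>2\<^sup>!\<close>, which is finite, so Chebyshev's inequality applies.
\<close>

section \<open>Random counting measures\<close>

text \<open>The variance only has to be bounded from above, so the reduced second factorial moment
  measure is dominated by \<gamma>^2 times Lebesgue measure plus the upper variation of
  \<open>beta2\<close>. The Lebesgue term contributes exactly the square of the mean; after
  subtracting it, the variance grows like the volume and not like its square. Three obstacles shape
  the proof. The sigma-algebra on configurations is generated by counts alone, so functionals of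
  pairs of points and sums over points have to be shown measurable. The variations are given through
  \<open>measure_of\<close>, which yields the zero measure unless the set function is countably
  additive, so their formulas must be established. Tuples of length \<open>n\<close> are extensional
  functions, hence the Slutsky argument moves test functions to a space of sequences. The constants
  fit because the limit of |T_r|^2 has mean \<gamma> S(k) and the random factor tends to
  1/\<gamma>.\<close>

lemma space_config_space: "space config_space = Collect loc_finite"
  unfolding config_space_def by (simp add: space_measure_of_conv)

lemma points_in_measurable [measurable]:
  fixes B :: "(real ^ 'd) set"
  assumes "B \<in> sets borel"
  shows "(\<lambda>\<phi>. points_in \<phi> B) \<in> borel_measurable config_space"
proof (rule measurableI)
  fix C :: "ennreal set" assume C: "C \<in> sets borel"
  let ?G = "{{\<phi>. loc_finite \<phi> \<and> points_in \<phi> B \<in> C} | B C. B \<in> sets (borel :: (real ^ 'd) measure) \<and> C \<in> sets borel}"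
  have eq: "(\<lambda>\<phi>. points_in \<phi> B) -` C \<inter> space config_space = {\<phi>. loc_finite \<phi> \<and> points_in \<phi> B \<in> C}"
    by (auto simp: space_config_space)
  have "{\<phi>. loc_finite \<phi> \<and> points_in \<phi> B \<in> C} \<in> ?G"
    using assms C by blast
  moreover have "?G \<subseteq> Pow (Collect loc_finite)" by blast
  ultimately have "{\<phi>. loc_finite \<phi> \<and> points_in \<phi> B \<in> C} \<in> sets config_space"
    unfolding config_space_def by (simp add: sets_measure_of)
  then show "(\<lambda>\<phi>. points_in \<phi> B) -` C \<inter> space config_space \<in> sets config_space"
    unfolding eq .
qed simp

text \<open>The counts generate the sigma-algebra, so it suffices to check them; shifts of
  configurations are treated this way.\<close>

lemma measurable_config_spaceI:
  fixes X :: "'w \<Rightarrow> (real ^ 'd) set"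
  assumes "\<And>\<omega>. \<omega> \<in> space M \<Longrightarrow> loc_finite (X \<omega>)"
    and "\<And>B. B \<in> sets borel \<Longrightarrow> (\<lambda>\<omega>. points_in (X \<omega>) B) \<in> borel_measurable M"
  shows "X \<in> measurable M config_space"
  unfolding config_space_def
proof (rule measurable_sigma_sets[OF sets_measure_of])
  fix y assume "y \<in> {{\<phi>. loc_finite \<phi> \<and> points_in \<phi> B \<in> C} | B C. B \<in> sets (borel :: (real ^ 'd) measure) \<and> C \<in> sets borel}"
  then obtain B C where y: "y = {\<phi>. loc_finite \<phi> \<and> points_in \<phi> B \<in> C}"
    and BC: "B \<in> sets borel" "C \<in> sets borel" by blast
  have "X -` y \<inter> space M = (\<lambda>\<omega>. points_in (X \<omega>) B) -` C \<inter> space M"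
    using assms(1) by (auto simp: y)
  with measurable_sets[OF assms(2)[OF BC(1)] BC(2)] show "X -` y \<inter> space M \<in> sets M"
    by simp
qed (use assms(1) in auto)

lemma points_in_shift: "points_in (shift x \<phi>) B = points_in \<phi> ((\<lambda>y. y + x) -` B)"
proof -
  have "bij_betw (\<lambda>y. y + x) (\<phi> \<inter> (\<lambda>y. y + x) -` B) (shift x \<phi> \<inter> B)"
    by (rule bij_betwI') (auto simp: shift_def)
  \<comment> \<open>Counting measure separates finite from infinite sets, so finiteness has to be
    transported along with the cardinality.\<close>
  then have "card (\<phi> \<inter> (\<lambda>y. y + x) -` B) = card (shift x \<phi> \<inter> B)"
    "finite (\<phi> \<inter> (\<lambda>y. y + x) -` B) \<longleftrightarrow> finite (shift x \<phi> \<inter> B)"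
    by (auto dest: bij_betw_same_card bij_betw_finite)
  then show ?thesis
    by (simp add: points_in_def emeasure_count_space)
qed

lemma loc_finite_shift:
  assumes "loc_finite \<phi>" shows "loc_finite (shift x \<phi>)"
  unfolding loc_finite_def
proof safe
  fix B :: "(real ^ 'a) set" assume "bounded B"
  then have "finite (\<phi> \<inter> (\<lambda>y. y - x) ` B)"
    using assms bounded_translation_minus unfolding loc_finite_def by blast
  moreover have "shift x \<phi> \<inter> B \<subseteq> (\<lambda>y. y + x) ` (\<phi> \<inter> (\<lambda>y. y - x) ` B)"
    by (force simp: shift_def)
  ultimately show "finite (shift x \<phi> \<inter> B)"
    using finite_surj by blast
qed

lemma shift_measurable: "shift x \<in> measurable config_space config_space"
proof (rule measurable_config_spaceI)
  fix B :: "(real ^ 'a) set" assume "B \<in> sets borel"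
  then have "(\<lambda>y. y + x) -` B \<in> sets borel"
    using measurable_sets[of "\<lambda>y. y + x" borel borel B] by simp
  then show "(\<lambda>\<phi>. points_in (shift x \<phi>) B) \<in> borel_measurable config_space"
    unfolding points_in_shift by measurable
qed (simp add: loc_finite_shift space_config_space)

lemma shift_0: "shift 0 \<phi> = \<phi>"
  by (simp add: shift_def)

text \<open>Stationarity compares the laws of any two shifts; taking the shift by 0, the identity,
  as the second one makes expectations of functionals invariant.\<close>

lemma stationary_nn_integral:
  assumes "point_process M \<eta>" "stationary M \<eta>" "G \<in> borel_measurable config_space"
  shows "(\<integral>\<^sup>+\<omega>. G (shift x (\<eta> \<omega>)) \<partial>M) = (\<integral>\<^sup>+\<omega>. G (\<eta> \<omega>) \<partial>M)"
proof -
  have [measurable]: "\<eta> \<in> measurable M config_space"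
    using assms(1) by (simp add: point_process_def)
  note [measurable] = shift_measurable assms(3)
  have "(\<integral>\<^sup>+\<omega>. G (shift x (\<eta> \<omega>)) \<partial>M) = (\<integral>\<^sup>+\<phi>. G \<phi> \<partial>distr M config_space (\<lambda>\<omega>. shift x (\<eta> \<omega>)))"
    by (subst nn_integral_distr) auto
  also have "distr M config_space (\<lambda>\<omega>. shift x (\<eta> \<omega>)) = distr M config_space (\<lambda>\<omega>. shift 0 (\<eta> \<omega>))"
    using assms(2) unfolding stationary_def by blast
  also have "(\<integral>\<^sup>+\<phi>. G \<phi> \<partial>distr M config_space (\<lambda>\<omega>. shift 0 (\<eta> \<omega>))) = (\<integral>\<^sup>+\<omega>. G (\<eta> \<omega>) \<partial>M)"
    by (subst nn_integral_distr) (auto simp: shift_0)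
  finally show ?thesis .
qed

section \<open>Integrals over random sets, mean measures and Campbell's formula\<close>

lemma nn_integral_indicator_count_space:
  "(\<integral>\<^sup>+x. indicator A x \<partial>count_space B) = emeasure (count_space UNIV) (B \<inter> A)"
  by (simp add: nn_integral_count_space_indicator indicator_inter_arith[symmetric] Int_commute
      flip: nn_integral_indicator)

text \<open>Induction over nonnegative measurable functions, stated for a general random set so that
  it covers a configuration and its set of pairs. The sum runs over \<open>\<Xi> \<omega>\<close>
  and not over \<open>space N\<close>; \<open>space N = UNIV\<close> allows functions agreeing on
  \<open>space N\<close> to be exchanged.\<close>

lemma nn_integral_random_set_measurable:
  assumes sp: "space N = UNIV"
    and m: "\<And>A. A \<in> sets N \<Longrightarrow> (\<lambda>\<omega>. emeasure (count_space UNIV) (\<Xi> \<omega> \<inter> A)) \<in> borel_measurable M"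
    and f: "f \<in> borel_measurable N"
  shows "(\<lambda>\<omega>. \<integral>\<^sup>+x. f x \<partial>count_space (\<Xi> \<omega>)) \<in> borel_measurable M"
  using f
proof (induction rule: borel_measurable_induct)
  case (cong f g)
  then show ?case using sp by simp
next
  case (set A)
  then show ?case by (simp add: nn_integral_indicator_count_space m)
next
  case (mult u c)
  then show ?case by (simp add: nn_integral_cmult)
next
  case (add u v)
  then show ?case by (simp add: nn_integral_add)
next
  case (seq U)
  have "(\<lambda>\<omega>. \<integral>\<^sup>+x. (SUP i. U i x) \<partial>count_space (\<Xi> \<omega>)) = (\<lambda>\<omega>. SUP i. \<integral>\<^sup>+x. U i x \<partial>count_space (\<Xi> \<omega>))"
    using seq by (auto intro!: ext nn_integral_monotone_convergence_SUP)
  with seq show ?case by (simp add: image_comp)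
qed

text \<open>The intensity measure of a random set; for
  \<open>\<Xi> \<omega> = \<eta> \<omega> \<times> \<eta> \<omega>\<close> it is the second moment
  measure.\<close>

definition mean_measure :: "'w measure \<Rightarrow> 'b measure \<Rightarrow> ('w \<Rightarrow> 'b set) \<Rightarrow> 'b measure" where
  "mean_measure M N \<Xi> = measure_of (space N) (sets N)
     (\<lambda>A. \<integral>\<^sup>+\<omega>. emeasure (count_space UNIV) (\<Xi> \<omega> \<inter> A) \<partial>M)"

lemma sets_mean_measure [measurable_cong]: "sets (mean_measure M N \<Xi>) = sets N"
  by (simp add: mean_measure_def)

lemma space_mean_measure: "space (mean_measure M N \<Xi>) = space N"
  by (simp add: mean_measure_def)

text \<open>Countable additivity is inherited from counting measure by exchanging sum and
  expectation, which is where the measurability of the counts enters.\<close>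

lemma emeasure_mean_measure:
  assumes m: "\<And>A. A \<in> sets N \<Longrightarrow> (\<lambda>\<omega>. emeasure (count_space UNIV) (\<Xi> \<omega> \<inter> A)) \<in> borel_measurable M"
    and A: "A \<in> sets N"
  shows "emeasure (mean_measure M N \<Xi>) A = (\<integral>\<^sup>+\<omega>. emeasure (count_space UNIV) (\<Xi> \<omega> \<inter> A) \<partial>M)"
proof (rule emeasure_measure_of[OF mean_measure_def])
  show "countably_additive (sets (mean_measure M N \<Xi>))
     (\<lambda>A. \<integral>\<^sup>+\<omega>. emeasure (count_space UNIV) (\<Xi> \<omega> \<inter> A) \<partial>M)"
  proof (rule countably_additiveI)
    fix F :: "nat \<Rightarrow> 'a set"
    assume F: "range F \<subseteq> sets (mean_measure M N \<Xi>)" "disjoint_family F"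
    have "(\<Sum>i. \<integral>\<^sup>+\<omega>. emeasure (count_space UNIV) (\<Xi> \<omega> \<inter> F i) \<partial>M)
        = (\<integral>\<^sup>+\<omega>. (\<Sum>i. emeasure (count_space UNIV) (\<Xi> \<omega> \<inter> F i)) \<partial>M)"
      using F(1) by (intro nn_integral_suminf[symmetric] m) (auto simp: sets_mean_measure)
    also have "\<dots> = (\<integral>\<^sup>+\<omega>. emeasure (count_space UNIV) (\<Xi> \<omega> \<inter> (\<Union>i. F i)) \<partial>M)"
    proof (intro nn_integral_cong)
      fix \<omega>
      have "disjoint_family (\<lambda>i. \<Xi> \<omega> \<inter> F i)"
        using F(2) by (auto simp: disjoint_family_on_def)
      then have "(\<Sum>i. emeasure (count_space UNIV) (\<Xi> \<omega> \<inter> F i))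
          = emeasure (count_space UNIV) (\<Union>i. \<Xi> \<omega> \<inter> F i)"
        by (intro suminf_emeasure) auto
      then show "(\<Sum>i. emeasure (count_space UNIV) (\<Xi> \<omega> \<inter> F i))
          = emeasure (count_space UNIV) (\<Xi> \<omega> \<inter> (\<Union>i. F i))" by simp
    qed
    finally show "(\<Sum>i. \<integral>\<^sup>+\<omega>. emeasure (count_space UNIV) (\<Xi> \<omega> \<inter> F i) \<partial>M)
        = (\<integral>\<^sup>+\<omega>. emeasure (count_space UNIV) (\<Xi> \<omega> \<inter> (\<Union>i. F i)) \<partial>M)" .
  qed
qed (use A in \<open>auto simp: positive_def sets_mean_measure dest: sets.sets_into_space\<close>)

text \<open>Campbell's formula, by induction over \<open>f\<close> starting from indicators.\<close>

lemma nn_integral_mean_measure: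
  assumes sp: "space N = UNIV"
    and m: "\<And>A. A \<in> sets N \<Longrightarrow> (\<lambda>\<omega>. emeasure (count_space UNIV) (\<Xi> \<omega> \<inter> A)) \<in> borel_measurable M"
    and f: "f \<in> borel_measurable N"
  shows "(\<integral>\<^sup>+x. f x \<partial>mean_measure M N \<Xi>) = (\<integral>\<^sup>+\<omega>. \<integral>\<^sup>+x. f x \<partial>count_space (\<Xi> \<omega>) \<partial>M)"
proof -
  have mm: "(\<lambda>\<omega>. \<integral>\<^sup>+x. f x \<partial>count_space (\<Xi> \<omega>)) \<in> borel_measurable M"
    if "f \<in> borel_measurable N" for f
    using sp m that by (rule nn_integral_random_set_measurable)
  from f show ?thesis
  proof (induction rule: borel_measurable_induct)
    case (cong f g)
    then show ?case using sp by simp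
  next
    case (set A)
    then show ?case
      by (simp add: nn_integral_indicator_count_space sets_mean_measure emeasure_mean_measure[OF m])
  next
    case (mult u c)
    have "u \<in> borel_measurable N" by fact
    from mult mm[OF this] show ?case
      by (simp add: nn_integral_cmult measurable_cong_sets[OF sets_mean_measure refl])
  next
    case (add u v)
    note [measurable] = mm add(1,3)
    from add show ?case by (simp add: nn_integral_add)
  next
    case (seq U)
    note [measurable] = mm seq(1)
    have "(\<integral>\<^sup>+x. (SUP i. U i x) \<partial>mean_measure M N \<Xi>) = (SUP i. \<integral>\<^sup>+x. U i x \<partial>mean_measure M N \<Xi>)"
      using seq by (intro nn_integral_monotone_convergence_SUP) auto
    also have "\<dots> = (SUP i. \<integral>\<^sup>+\<omega>. \<integral>\<^sup>+x. U i x \<partial>count_space (\<Xi> \<omega>) \<partial>M)"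
      using seq by simp
    also have "\<dots> = (\<integral>\<^sup>+\<omega>. (SUP i. \<integral>\<^sup>+x. U i x \<partial>count_space (\<Xi> \<omega>)) \<partial>M)"
      using seq by (intro nn_integral_monotone_convergence_SUP[symmetric])
        (auto simp: incseq_def le_fun_def intro!: nn_integral_mono)
    also have "\<dots> = (\<integral>\<^sup>+\<omega>. \<integral>\<^sup>+x. (SUP i. U i x) \<partial>count_space (\<Xi> \<omega>) \<partial>M)"
      using seq by (intro nn_integral_cong nn_integral_monotone_convergence_SUP[symmetric]) auto
    finally show ?case by (simp add: image_comp)
  qed
qed

section \<open>Measurability of counts of pairs of points\<close>

lemma emeasure_count_space_times_bounded:
  assumes "loc_finite \<phi>" "bounded A" "bounded B"
  shows "emeasure (count_space UNIV) ((\<phi> \<times> \<phi>) \<inter> (A \<times> B)) = points_in \<phi> A * points_in \<phi> B"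
proof -
  have "finite (\<phi> \<inter> A)" "finite (\<phi> \<inter> B)"
    using assms by (auto simp: loc_finite_def)
  then show ?thesis
    by (simp add: points_in_def Times_Int_Times card_cartesian_product flip: ennreal_mult' of_nat_mult)
qed

text \<open>Rectangles form an intersection-stable generator on which the count is a product of two
  counts, and a Dynkin argument extends this to all sets. The complement step subtracts counts,
  which must be finite; hence the localization to \<open>V m \<times> V m\<close>, removed at the
  end by a supremum over \<open>m\<close>.\<close>

lemma emeasure_count_space_pairs_measurable:
  fixes A :: "((real ^ 'd) \<times> (real ^ 'd)) set"
  assumes "A \<in> sets (borel \<Otimes>\<^sub>M borel)"
  shows "(\<lambda>\<phi>. emeasure (count_space UNIV) ((\<phi> \<times> \<phi>) \<inter> A)) \<in> borel_measurable config_space"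
proof -
  define V :: "nat \<Rightarrow> (real ^ 'd) set" where "V m = cball 0 (real m)" for m
  have V: "bounded (V m)" "V m \<in> sets borel" for m
    by (auto simp: V_def)
  let ?c = "\<lambda>m A \<phi>. emeasure (count_space UNIV) ((\<phi> \<times> \<phi>) \<inter> (A \<inter> V m \<times> V m))"
  have fin: "finite ((\<phi> \<times> \<phi>) \<inter> (A \<inter> V m \<times> V m))" if "loc_finite \<phi>" for \<phi> A m
  proof (rule finite_subset)
    show "finite ((\<phi> \<inter> V m) \<times> (\<phi> \<inter> V m))"
      using that V by (auto simp: loc_finite_def)
  qed auto
  have rect: "?c m (a \<times> b) \<in> borel_measurable config_space"
    if "a \<in> sets borel" "b \<in> sets borel" for m a b
  proof (subst measurable_cong)
    fix \<phi> :: "(real ^ 'd) set" assume "\<phi> \<in> space config_space"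
    then have "loc_finite \<phi>" by (simp add: space_config_space)
    with emeasure_count_space_times_bounded[of \<phi> "a \<inter> V m" "b \<inter> V m"] V
    show "?c m (a \<times> b) \<phi> = points_in \<phi> (a \<inter> V m) * points_in \<phi> (b \<inter> V m)"
      by (auto simp: Times_Int_Times intro: bounded_subset)
  next
    show "(\<lambda>\<phi>. points_in \<phi> (a \<inter> V m) * points_in \<phi> (b \<inter> V m)) \<in> borel_measurable config_space"
      using that V by measurable
  qed
  have m: "?c m A \<in> borel_measurable config_space" for m
  proof -
    have A: "A \<in> sigma_sets UNIV {a \<times> b | a b. a \<in> sets (borel :: (real ^ 'd) measure) \<and> b \<in> sets (borel :: (real ^ 'd) measure)}"
      using assms by (simp add: sets_pair_measure)
    have I: "Int_stable {a \<times> b | a b. a \<in> sets (borel :: (real ^ 'd) measure) \<and> b \<in> sets (borel :: (real ^ 'd) measure)}"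
      by (rule Int_stable_pair_measure_generator)
    have P: "{a \<times> b | a b. a \<in> sets (borel :: (real ^ 'd) measure) \<and> b \<in> sets (borel :: (real ^ 'd) measure)} \<subseteq> Pow UNIV"
      by simp
    from I P A show ?thesis
    proof (induction A rule: sigma_sets_induct_disjoint)
      case (basic A)
      then show ?case using rect by auto
    next
      case empty
      then show ?case by simp
    next
      case (compl A)
      have U: "?c m (UNIV \<times> UNIV) \<in> borel_measurable config_space"
        by (rule rect) auto
      have "?c m (UNIV - A) \<phi> = ?c m (UNIV \<times> UNIV) \<phi> - ?c m A \<phi>" if "loc_finite \<phi>" for \<phi>
      proof -
        have "(\<phi> \<times> \<phi>) \<inter> ((UNIV - A) \<inter> V m \<times> V m)
            = ((\<phi> \<times> \<phi>) \<inter> ((UNIV \<times> UNIV) \<inter> V m \<times> V m)) - ((\<phi> \<times> \<phi>) \<inter> (A \<inter> V m \<times> V m))"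
          by auto
        then show ?thesis
          using fin[OF that] by (simp only:) (intro emeasure_Diff, auto)
      qed
      then show ?case
        using compl(2) U by (subst measurable_cong[where g = "\<lambda>\<phi>. ?c m (UNIV \<times> UNIV) \<phi> - ?c m A \<phi>"])
          (auto simp: space_config_space)
    next
      case (union A)
      have "?c m (\<Union>i. A i) \<phi> = (\<Sum>i. ?c m (A i) \<phi>)" for \<phi>
      proof -
        have "disjoint_family (\<lambda>i. (\<phi> \<times> \<phi>) \<inter> (A i \<inter> V m \<times> V m))"
          using union(1) by (auto simp: disjoint_family_on_def)
        then have "(\<Sum>i. ?c m (A i) \<phi>) = emeasure (count_space UNIV) (\<Union>i. (\<phi> \<times> \<phi>) \<inter> (A i \<inter> V m \<times> V m))"
          by (intro suminf_emeasure) auto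
        also have "(\<Union>i. (\<phi> \<times> \<phi>) \<inter> (A i \<inter> V m \<times> V m)) = (\<phi> \<times> \<phi>) \<inter> ((\<Union>i. A i) \<inter> V m \<times> V m)"
          by auto
        finally show ?thesis by simp
      qed
      with union(3) show ?case by simp
    qed
  qed
  have "(\<lambda>\<phi>. SUP m. ?c m A \<phi>) \<in> borel_measurable config_space"
    using m by simp
  moreover have "(SUP m. ?c m A \<phi>) = emeasure (count_space UNIV) ((\<phi> \<times> \<phi>) \<inter> A)" for \<phi>
  proof -
    have "(SUP m. ?c m A \<phi>) = emeasure (count_space UNIV) (\<Union>m. (\<phi> \<times> \<phi>) \<inter> (A \<inter> V m \<times> V m))"
      by (intro SUP_emeasure_incseq) (auto simp: incseq_def V_def)
    also have "(\<Union>m. (\<phi> \<times> \<phi>) \<inter> (A \<inter> V m \<times> V m)) = (\<phi> \<times> \<phi>) \<inter> A"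
    proof -
      have "\<exists>m. x \<in> V m \<and> y \<in> V m" for x y
        using real_arch_simple[of "max (norm x) (norm y)"] by (auto simp: V_def)
      then show ?thesis by auto
    qed
    finally show ?thesis .
  qed
  ultimately show ?thesis by simp
qed

section \<open>Upper variation\<close>

text \<open>Domination on sets passes to nonnegative functions by induction. It turns the bound on
  the reduced second factorial moment measure into a bound on integrals.\<close>

lemma nn_integral_le_add:
  assumes "sets \<mu> = sets \<alpha>" "sets \<nu> = sets \<alpha>"
    and le: "\<And>A. A \<in> sets \<alpha> \<Longrightarrow> emeasure \<alpha> A \<le> emeasure \<mu> A + emeasure \<nu> A"
    and "f \<in> borel_measurable \<alpha>"
  shows "(\<integral>\<^sup>+x. f x \<partial>\<alpha>) \<le> (\<integral>\<^sup>+x. f x \<partial>\<mu>) + (\<integral>\<^sup>+x. f x \<partial>\<nu>)"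
proof -
  note [measurable_cong] = assms(1,2)
  note sp = sets_eq_imp_space_eq[OF assms(1)] sets_eq_imp_space_eq[OF assms(2)]
  from assms(4) show ?thesis
  proof (induction rule: borel_measurable_induct)
    case (cong f g)
    then have "integral\<^sup>N \<alpha> f = integral\<^sup>N \<alpha> g" "integral\<^sup>N \<mu> f = integral\<^sup>N \<mu> g" "integral\<^sup>N \<nu> f = integral\<^sup>N \<nu> g"
      using sp by (auto intro!: nn_integral_cong)
    with cong show ?case by simp
  next
    case (set A)
    then show ?case using assms(1,2) by (simp add: le)
  next
    case (mult u c)
    have [measurable]: "u \<in> borel_measurable \<alpha>" by fact
    from mult show ?case
      by (simp add: nn_integral_cmult distrib_left[symmetric] mult_left_mono)
  next
    case (add u v)
    have [measurable]: "u \<in> borel_measurable \<alpha>" "v \<in> borel_measurable \<alpha>" by fact+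
    have "integral\<^sup>N \<alpha> u + integral\<^sup>N \<alpha> v
        \<le> (integral\<^sup>N \<mu> u + integral\<^sup>N \<nu> u) + (integral\<^sup>N \<mu> v + integral\<^sup>N \<nu> v)"
      by (intro add_mono add)
    then show ?case
      by (simp add: nn_integral_add ac_simps)
  next
    case (seq U)
    have [measurable]: "U i \<in> borel_measurable \<alpha>" for i by (rule seq)
    have "(\<integral>\<^sup>+x. (SUP i. U i x) \<partial>\<alpha>) = (SUP i. \<integral>\<^sup>+x. U i x \<partial>\<alpha>)"
      using seq by (intro nn_integral_monotone_convergence_SUP) auto
    also have "\<dots> \<le> (\<integral>\<^sup>+x. (SUP i. U i x) \<partial>\<mu>) + (\<integral>\<^sup>+x. (SUP i. U i x) \<partial>\<nu>)"
    proof (rule SUP_least)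
      fix i
      have "(\<integral>\<^sup>+x. U i x \<partial>\<alpha>) \<le> (\<integral>\<^sup>+x. U i x \<partial>\<mu>) + (\<integral>\<^sup>+x. U i x \<partial>\<nu>)"
        by (rule seq)
      also have "\<dots> \<le> (\<integral>\<^sup>+x. (SUP i. U i x) \<partial>\<mu>) + (\<integral>\<^sup>+x. (SUP i. U i x) \<partial>\<nu>)"
        by (intro add_mono nn_integral_mono SUP_upper) auto
      finally show "(\<integral>\<^sup>+x. U i x \<partial>\<alpha>) \<le> \<dots>" .
    qed
    finally show ?case by (simp add: image_comp)
    qed
qed

lemma sets_upper_variation [measurable_cong]: "sets (upper_variation \<nu>) = sets borel"
  using sets.sigma_sets_eq[of borel] by (simp add: upper_variation_def)

lemma sets_lower_variation [measurable_cong]: "sets (lower_variation \<nu>) = sets borel"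
  by (simp add: lower_variation_def sets_upper_variation)

lemma sets_total_variation [measurable_cong]: "sets (total_variation \<nu>) = sets borel"
  using sets.sigma_sets_eq[of borel] by (simp add: total_variation_def)

text \<open>The point is countable additivity of the supremum. For one inequality, a bounded subset
  of the union is cut along the pieces; for the other, nearly optimal subsets of the first
  \<open>n\<close> pieces are united, and a union of finitely many bounded sets is again
  bounded.\<close>

lemma emeasure_upper_variation:
  fixes \<nu> :: "(real ^ 'd) set \<Rightarrow> real"
  assumes sums: "\<And>A :: nat \<Rightarrow> (real ^ 'd) set. range A \<subseteq> sets borel \<Longrightarrow> disjoint_family A \<Longrightarrow>
      bounded (\<Union>i. A i) \<Longrightarrow> (\<lambda>i. \<nu> (A i)) sums \<nu> (\<Union>i. A i)"
    and B: "B \<in> sets borel"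
  shows "emeasure (upper_variation \<nu>) B = (SUP A \<in> {A \<in> sets borel. bounded A \<and> A \<subseteq> B}. ennreal (\<nu> A))"
proof -
  let ?p = "\<lambda>B. SUP A \<in> {A \<in> sets borel. bounded A \<and> A \<subseteq> B}. ennreal (\<nu> A)"
  have empty: "\<nu> {} = 0"
  \<comment> \<open>A convergent series with constant terms has terms 0.\<close>
  proof -
    have "(\<lambda>i::nat. \<nu> {}) sums \<nu> {}"
      using sums[of "\<lambda>_. {}"] by (simp add: disjoint_family_on_def)
    then show ?thesis
      using summable_LIMSEQ_zero[OF sums_summable] LIMSEQ_const_iff by blast
  qed
  have finsum: "\<nu> (\<Union>i<n. A i) = (\<Sum>i<n. \<nu> (A i))"
    if "\<And>i. i < n \<Longrightarrow> A i \<in> sets borel \<and> bounded (A i)" "disjoint_family_on A {..<n}" for n :: nat and A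
  proof -
    define A' where "A' i = (if i < n then A i else {})" for i
    have "(\<Union>i. A' i) = (\<Union>i<n. A i)" by (auto simp: A'_def)
    moreover have "(\<lambda>i. \<nu> (A' i)) sums \<nu> (\<Union>i. A' i)"
      using that by (intro sums) (auto simp: A'_def disjoint_family_on_def)
    moreover have "(\<lambda>i. \<nu> (A' i)) sums (\<Sum>i<n. \<nu> (A' i))"
      by (rule sums_finite) (auto simp: A'_def empty)
    moreover have "(\<Sum>i<n. \<nu> (A' i)) = (\<Sum>i<n. \<nu> (A i))"
      by (simp add: A'_def)
    ultimately show ?thesis
      using sums_unique2 by metis
  qed
  show ?thesis
  proof (rule emeasure_measure_of[OF upper_variation_def])
    show "positive (sets (upper_variation \<nu>)) ?p"
    proof -
      have "{A \<in> sets borel. bounded A \<and> A \<subseteq> {}} = {{} :: (real ^ 'd) set}" by auto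
      then show ?thesis by (simp add: positive_def empty)
    qed
    have "(\<Sum>i. ?p (F i)) = ?p (\<Union>i. F i)"
      if F: "range F \<subseteq> sets borel" "disjoint_family F" for F :: "nat \<Rightarrow> (real ^ 'd) set"
    proof (rule antisym)
      show "?p (\<Union>i. F i) \<le> (\<Sum>i. ?p (F i))"
      proof (rule SUP_least, safe)
        fix A assume A: "A \<in> sets borel" "bounded A" "A \<subseteq> (\<Union>i. F i)"
        have "(\<lambda>i. \<nu> (A \<inter> F i)) sums \<nu> (\<Union>i. A \<inter> F i)"
          using F A by (intro sums) (auto simp: disjoint_family_on_def intro: bounded_subset[OF A(2)])
        also have "(\<Union>i. A \<inter> F i) = A" using A by auto
        finally have s: "(\<lambda>i. \<nu> (A \<inter> F i)) sums \<nu> A" .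
        have "ennreal (\<Sum>i<n. \<nu> (A \<inter> F i)) \<le> (\<Sum>i. ?p (F i))" for n
        proof -
          \<comment> \<open>Since \<open>ennreal\<close> sends negative numbers to 0, it is additive
            only on nonnegative terms; negative values of \<open>\<nu>\<close> are first raised to
            0.\<close>
          have "ennreal (\<Sum>i<n. \<nu> (A \<inter> F i)) \<le> ennreal (\<Sum>i<n. max 0 (\<nu> (A \<inter> F i)))"
            by (intro ennreal_leI sum_mono) auto
          also have "\<dots> = (\<Sum>i<n. ennreal (\<nu> (A \<inter> F i)))"
            by (subst sum_ennreal[symmetric]) auto
          also have "\<dots> \<le> (\<Sum>i<n. ?p (F i))"
            using F A by (intro sum_mono SUP_upper) (auto intro: bounded_subset[OF A(2)])
          also have "\<dots> \<le> (\<Sum>i. ?p (F i))"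
            by (rule sum_le_suminf) auto
          finally show ?thesis .
        qed
        moreover have "(\<lambda>n. ennreal (\<Sum>i<n. \<nu> (A \<inter> F i))) \<longlonglongrightarrow> ennreal (\<nu> A)"
          using s unfolding sums_def by (rule tendsto_ennrealI)
        ultimately show "ennreal (\<nu> A) \<le> (\<Sum>i. ?p (F i))"
          by (intro LIMSEQ_le_const2) auto
      qed
      have "(\<Sum>i<n. ?p (F i)) \<le> ?p (\<Union>i. F i)" for n
      proof (rule ennreal_le_epsilon)
        fix e :: real assume "e > 0" and fin: "?p (\<Union>i. F i) < top"
        \<comment> \<open>The error \<open>d\<close> is spent \<open>n\<close> times; the summand 1
          keeps the denominator positive for \<open>n = 0\<close>.\<close>
        define d where "d = e / (real n + 1)"
        have d: "d > 0" "real n * d \<le> e"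
          using \<open>e > 0\<close> by (auto simp: d_def field_simps)
        \<comment> \<open>Nonnegativity of \<open>\<nu> A\<close> is demanded so that the sum can
          later be moved inside \<open>ennreal\<close>. If the supremum is 0, the empty set serves;
          otherwise the supremum is positive and finite, and subtracting \<open>d\<close> strictly
          decreases it.\<close>
        have "\<exists>A. A \<in> sets borel \<and> bounded A \<and> A \<subseteq> F i \<and> 0 \<le> \<nu> A \<and> ?p (F i) \<le> ennreal (\<nu> A) + ennreal d" for i
        proof -
          have le: "?p (F i) \<le> ?p (\<Union>i. F i)"
            by (rule SUP_subset_mono) auto
          show ?thesis
          proof (cases "?p (F i) = 0")
            case True
            then show ?thesis using empty by (intro exI[of _ "{}"]) auto
          next
            case False
            have "?p (F i) < top" using le fin by (rule le_less_trans)
            then have "?p (F i) - ennreal d < ?p (F i)"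
              using False d(1) by (intro ennreal_between) (auto simp: zero_less_iff_neq_zero)
            then obtain A where A: "A \<in> sets borel" "bounded A" "A \<subseteq> F i" "?p (F i) - ennreal d < ennreal (\<nu> A)"
              unfolding less_SUP_iff by auto
            have "0 \<le> \<nu> A" using A(4) by (cases "0 \<le> \<nu> A") (auto simp: ennreal_neg)
            moreover have "?p (F i) \<le> ennreal (\<nu> A) + ennreal d"
              using less_imp_le[OF A(4)] unfolding ennreal_minus_le_iff by (simp add: add.commute)
            ultimately show ?thesis using A by blast
          qed
        qed
        then have "\<forall>i. \<exists>A. A \<in> sets borel \<and> bounded A \<and> A \<subseteq> F i \<and> 0 \<le> \<nu> A \<and> ?p (F i) \<le> ennreal (\<nu> A) + ennreal d" ..
        from choice[OF this] obtain A where A: "\<And>i. A i \<in> sets borel" "\<And>i. bounded (A i)" "\<And>i. A i \<subseteq> F i" "\<And>i. 0 \<le> \<nu> (A i)"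
          "\<And>i. ?p (F i) \<le> ennreal (\<nu> (A i)) + ennreal d" by auto
        have "(\<Sum>i<n. ?p (F i)) \<le> (\<Sum>i<n. ennreal (\<nu> (A i)) + ennreal d)"
          by (intro sum_mono A)
        also have "\<dots> = ennreal (\<Sum>i<n. \<nu> (A i)) + ennreal (real n * d)"
          using A(4) d by (simp add: sum.distrib sum_ennreal ennreal_mult ennreal_of_nat_eq_real_of_nat)
        also have "(\<Sum>i<n. \<nu> (A i)) = \<nu> (\<Union>i<n. A i)"
        proof (rule finsum[symmetric])
          show "disjoint_family_on A {..<n}"
            unfolding disjoint_family_on_def
          proof (intro ballI impI)
            fix i j :: nat assume "i \<noteq> j"
            then have "F i \<inter> F j = {}" using F(2) by (simp add: disjoint_family_on_def)
            then show "A i \<inter> A j = {}" using A(3)[of i] A(3)[of j] by blast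
          qed
        qed (use A in auto)
        also have "ennreal (\<nu> (\<Union>i<n. A i)) \<le> ?p (\<Union>i. F i)"
          using A by (intro SUP_upper) (auto 0 3 intro!: bounded_UN dest: subsetD[OF A(3)])
        also have "ennreal (real n * d) \<le> ennreal e"
          using d by (intro ennreal_leI)
        finally show "(\<Sum>i<n. ?p (F i)) \<le> ?p (\<Union>i. F i) + ennreal e"
          by (simp add: add_mono)
      qed
      then show "(\<Sum>i. ?p (F i)) \<le> ?p (\<Union>i. F i)"
        by (intro suminf_le_const) auto
    qed
    then show "countably_additive (sets (upper_variation \<nu>)) ?p"
      by (intro countably_additiveI) (auto simp: sets_upper_variation)
  qed (use B in \<open>auto simp: sets_upper_variation\<close>)
qed

text \<open>Valid for every \<open>\<nu>\<close>: both variations are measures by their type,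
  whatever their defining formulas do, and a sum of two measures is countably additive.\<close>

lemma emeasure_total_variation:
  assumes "B \<in> sets borel"
  shows "emeasure (total_variation \<nu>) B = emeasure (upper_variation \<nu>) B + emeasure (lower_variation \<nu>) B"
proof (rule emeasure_measure_of[OF total_variation_def])
  have "(\<Sum>i. emeasure (upper_variation \<nu>) (F i) + emeasure (lower_variation \<nu>) (F i))
      = emeasure (upper_variation \<nu>) (\<Union>i. F i) + emeasure (lower_variation \<nu>) (\<Union>i. F i)"
    if F: "range F \<subseteq> sets borel" "disjoint_family F" for F :: "nat \<Rightarrow> _"
    using F by (subst suminf_add[symmetric]) (auto simp: suminf_emeasure sets_upper_variation sets_lower_variation)
  then show "countably_additive (sets (total_variation \<nu>))
     (\<lambda>B. emeasure (upper_variation \<nu>) B + emeasure (lower_variation \<nu>) B)"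
    by (intro countably_additiveI) (auto simp: sets_total_variation)
qed (use assms in \<open>auto simp: positive_def sets_total_variation\<close>)

section \<open>First and second moments of stationary point processes\<close>

text \<open>Insert \<open>1 = \<integral> 1\<^sub>C(pos b + t) dt\<close>, apply Fubini and shift \<open>b\<close> by \<open>-t\<close>.\<close>

lemma nn_integral_averaging:
  fixes pos :: "'b \<Rightarrow> 'a::euclidean_space"
  assumes "sigma_finite_measure \<kappa>"
    and [measurable]: "pos \<in> borel_measurable \<kappa>" "(\<lambda>(t, b). act t b) \<in> measurable (lborel \<Otimes>\<^sub>M \<kappa>) \<kappa>"
    and inv: "\<And>t f. f \<in> borel_measurable \<kappa> \<Longrightarrow> (\<integral>\<^sup>+b. f (act t b) \<partial>\<kappa>) = (\<integral>\<^sup>+b. f b \<partial>\<kappa>)"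
    and pos: "\<And>t b. pos (act t b) = pos b + t"
    and act: "\<And>t b. act (- t) (act t b) = b"
    and [measurable]: "f \<in> borel_measurable \<kappa>" "C \<in> sets borel"
    and C: "emeasure lborel C = 1"
  shows "(\<integral>\<^sup>+b. f b \<partial>\<kappa>) = (\<integral>\<^sup>+b. indicator C (pos b) * (\<integral>\<^sup>+t. f (act (- t) b) \<partial>lborel) \<partial>\<kappa>)"
proof -
  interpret \<kappa>: sigma_finite_measure \<kappa> by fact
  interpret pair_sigma_finite lborel \<kappa> ..
  have [measurable]: "(\<lambda>x. act (- fst x) (snd x)) \<in> measurable (lborel \<Otimes>\<^sub>M \<kappa>) \<kappa>"
    using measurable_compose[OF _ assms(3), of "\<lambda>x. (- fst x, snd x)" "lborel \<Otimes>\<^sub>M \<kappa>"] by simp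
  have [measurable]: "act t \<in> measurable \<kappa> \<kappa>" for t
    using measurable_compose[OF _ assms(3), of "\<lambda>b. (t, b)" \<kappa>] by simp
  have F1: "(\<lambda>x. indicator C (pos (snd x)) * f (act (- fst x) (snd x))) \<in> borel_measurable (lborel \<Otimes>\<^sub>M \<kappa>)"
    by measurable
  have F2: "(\<lambda>x. indicator C (pos (snd x) + fst x) * f (snd x)) \<in> borel_measurable (lborel \<Otimes>\<^sub>M \<kappa>)"
    by measurable
  have F1: "(\<lambda>x. indicator C (pos (snd x)) * f (act (- fst x) (snd x))) \<in> borel_measurable (lborel \<Otimes>\<^sub>M \<kappa>)"
    by measurable
  have F2: "(\<lambda>x. indicator C (pos (snd x) + fst x) * f (snd x)) \<in> borel_measurable (lborel \<Otimes>\<^sub>M \<kappa>)"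
    by measurable
  have C': "(\<integral>\<^sup>+t. indicator C (x + t) \<partial>lborel) = (1 :: ennreal)" for x :: 'a
  proof -
    have "(\<integral>\<^sup>+t. indicator C (x + t) \<partial>lborel) = (\<integral>\<^sup>+t. indicator C t \<partial>distr lborel borel ((+) x) :: ennreal)"
      by (subst nn_integral_distr) auto
    then show ?thesis
      using C by (simp add: lborel_distr_plus)
  qed
  have "(\<integral>\<^sup>+b. indicator C (pos b) * (\<integral>\<^sup>+t. f (act (- t) b) \<partial>lborel) \<partial>\<kappa>)
      = (\<integral>\<^sup>+b. \<integral>\<^sup>+t. indicator C (pos b) * f (act (- t) b) \<partial>lborel \<partial>\<kappa>)"
  proof (rule nn_integral_cong)
    fix b assume "b \<in> space \<kappa>"
    then have "(\<lambda>t. (- t, b)) \<in> measurable lborel (lborel \<Otimes>\<^sub>M \<kappa>)"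
      by measurable
    from measurable_compose[OF this assms(3)]
    have "(\<lambda>t. f (act (- t) b)) \<in> borel_measurable lborel"
      by (intro measurable_compose[OF _ assms(7)]) simp
    then show "indicator C (pos b) * (\<integral>\<^sup>+t. f (act (- t) b) \<partial>lborel)
        = (\<integral>\<^sup>+t. indicator C (pos b) * f (act (- t) b) \<partial>lborel)"
      by (simp add: nn_integral_cmult)
  qed
  also have "\<dots> = (\<integral>\<^sup>+t. \<integral>\<^sup>+b. indicator C (pos b) * f (act (- t) b) \<partial>\<kappa> \<partial>lborel)"
    using F1 by (intro Fubini') (simp add: case_prod_beta)
  also have "\<dots> = (\<integral>\<^sup>+t. \<integral>\<^sup>+b. indicator C (pos b + t) * f b \<partial>\<kappa> \<partial>lborel)"
  proof (rule nn_integral_cong)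
    fix t
    have "(\<integral>\<^sup>+b. indicator C (pos (act t b)) * f (act (- t) (act t b)) \<partial>\<kappa>)
        = (\<integral>\<^sup>+b. indicator C (pos b) * f (act (- t) b) \<partial>\<kappa>)"
      by (rule inv) measurable
    then show "(\<integral>\<^sup>+b. indicator C (pos b) * f (act (- t) b) \<partial>\<kappa>) = (\<integral>\<^sup>+b. indicator C (pos b + t) * f b \<partial>\<kappa>)"
      by (simp add: pos act)
  qed
  also have "\<dots> = (\<integral>\<^sup>+b. \<integral>\<^sup>+t. indicator C (pos b + t) * f b \<partial>lborel \<partial>\<kappa>)"
    using F2 by (intro Fubini'[symmetric]) (simp add: case_prod_beta)
  also have "\<dots> = (\<integral>\<^sup>+b. f b \<partial>\<kappa>)"
    by (simp add: nn_integral_multc C')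
  finally show ?thesis ..
qed

lemma emeasure_lborel_cbox_cart:
  fixes a b :: "real ^ 'd"
  assumes "\<And>i. a $ i \<le> b $ i"
  shows "emeasure lborel (cbox a b) = ennreal (\<Prod>i\<in>UNIV. b $ i - a $ i)"
proof -
  have "cbox a b \<noteq> {}" using assms by (auto simp: interval_eq_empty_cart not_less)
  then have "measure lborel (cbox a b) = (\<Prod>i\<in>UNIV. b $ i - a $ i)"
    by (rule content_cbox_cart)
  then show ?thesis
    using emeasure_eq_ennreal_measure[of lborel "cbox a b"] emeasure_lborel_cbox_finite[of a b] by simp
qed

lemma unit_cube_sets [measurable]: "unit_cube \<in> sets borel"
  by (simp add: unit_cube_def)

lemma emeasure_unit_cube: "emeasure lborel (unit_cube :: (real ^ 'd) set) = 1"
  unfolding unit_cube_def by (subst emeasure_lborel_cbox_cart) auto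

lemma bounded_window: "bounded (window r)" and window_sets: "window r \<in> sets borel"
  by (simp_all add: window_def bounded_cbox)

lemma emeasure_window:
  assumes "r \<ge> 0"
  shows "emeasure lborel (window r :: (real ^ 'd) set) = ennreal (r ^ CARD('d))"
  unfolding window_def using assms by (subst emeasure_lborel_cbox_cart) auto

text \<open>Affine substitution with slope -1, whose Jacobian has absolute value 1.\<close>

lemma nn_integral_lborel_reflect:
  fixes h :: "'a::euclidean_space \<Rightarrow> ennreal"
  assumes [measurable]: "h \<in> borel_measurable borel"
  shows "(\<integral>\<^sup>+t. h (x - t) \<partial>lborel) = (\<integral>\<^sup>+t. h t \<partial>lborel)"
proof -
  have "(\<integral>\<^sup>+t. h t \<partial>lborel) = (\<integral>\<^sup>+t. h t \<partial>density (distr lborel borel (\<lambda>y. x + (- 1) *\<^sub>R y)) (\<lambda>_. ennreal (\<bar>- 1\<bar> ^ DIM('a))))"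
    by (subst lborel_affine[of "- 1" x]) simp_all
  also have "\<dots> = (\<integral>\<^sup>+t. h (x - t) \<partial>lborel)"
    by (simp add: density_1 nn_integral_distr)
  finally show ?thesis ..
qed

text \<open>The map sending \<open>x\<close> to \<open>(x, x)\<close> embeds the points into the
  pairs, so sums over points become sums over pairs.\<close>

lemma nn_integral_count_space_diagonal:
  "(\<integral>\<^sup>+p. indicator {p. fst p = snd p \<and> fst p \<in> W} p * h p \<partial>count_space (\<phi> \<times> \<phi>))
    = (\<integral>\<^sup>+x. indicator W x * h (x, x) \<partial>count_space \<phi>)"
proof -
  have "(\<integral>\<^sup>+x. indicator W x * h (x, x) \<partial>count_space \<phi>)
      = (\<integral>\<^sup>+p. indicator {p. fst p = snd p \<and> fst p \<in> W} p * h p \<partial>count_space ((\<lambda>x. (x, x)) ` \<phi>))"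
    by (subst nn_integral_bij_count_space[symmetric, of "\<lambda>x. (x, x)" \<phi>])
      (auto intro!: nn_integral_cong inj_on_imp_bij_betw simp: inj_on_def indicator_def)
  also have "\<dots> = (\<integral>\<^sup>+p. indicator {p. fst p = snd p \<and> fst p \<in> W} p * h p \<partial>count_space (\<phi> \<times> \<phi>))"
    by (subst (1 2) nn_integral_count_space_indicator) (auto intro!: nn_integral_cong simp: indicator_def)
  finally show ?thesis ..
qed

lemma diagonal_sets:
  assumes [measurable]: "W \<in> sets (borel :: (real ^ 'd) measure)"
  shows "{p. fst p = snd p \<and> fst p \<in> W} \<in> sets (borel \<Otimes>\<^sub>M borel)"
proof -
  have "{p \<in> space (borel \<Otimes>\<^sub>M borel). fst p = snd p \<and> fst p \<in> W} \<in> sets (borel \<Otimes>\<^sub>M borel)"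
    by measurable
  then show ?thesis by (simp add: space_pair_measure)
qed

section \<open>The second moment measure of a stationary process and its shift invariance\<close>

locale stationary_point_process =
  fixes M :: "'w measure" and \<eta> :: "'w \<Rightarrow> (real ^ 'd) set" and \<gamma> :: real
  assumes pp: "point_process M \<eta>"
    and stat: "stationary M \<eta>"
    and lsi: "loc_square_integrable M \<eta>"
    and \<gamma>_nonneg: "\<gamma> \<ge> 0"
    and int: "intensity M \<eta> = ennreal \<gamma>"
begin

sublocale prob_space M
  using pp by (simp add: point_process_def)

lemma \<eta>_measurable [measurable]: "\<eta> \<in> measurable M config_space"
  using pp by (simp add: point_process_def)

lemma loc_finite_\<eta>: "\<omega> \<in> space M \<Longrightarrow> loc_finite (\<eta> \<omega>)"
  using measurable_space[OF \<eta>_measurable] by (simp add: space_config_space)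

text \<open>The mean number of points is read off the diagonal of \<open>\<eta> \<times> \<eta>\<close>, the second factorial
  moment off its complement, so the averaging lemma is needed for this measure only.\<close>

definition \<kappa> :: "((real ^ 'd) \<times> (real ^ 'd)) measure" where
  "\<kappa> = mean_measure M (borel \<Otimes>\<^sub>M borel) (\<lambda>\<omega>. \<eta> \<omega> \<times> \<eta> \<omega>)"

lemma sets_\<kappa> [measurable_cong]: "sets \<kappa> = sets (borel \<Otimes>\<^sub>M borel)"
  by (simp add: \<kappa>_def sets_mean_measure)

lemma space_\<kappa>: "space \<kappa> = UNIV"
  by (simp add: \<kappa>_def space_mean_measure space_pair_measure)

lemma pairs_measurable:
  "A \<in> sets (borel \<Otimes>\<^sub>M borel) \<Longrightarrow>
    (\<lambda>\<omega>. emeasure (count_space UNIV) ((\<eta> \<omega> \<times> \<eta> \<omega>) \<inter> A)) \<in> borel_measurable M"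
  by (rule measurable_compose[OF \<eta>_measurable emeasure_count_space_pairs_measurable])

lemma emeasure_\<kappa>:
  "A \<in> sets (borel \<Otimes>\<^sub>M borel) \<Longrightarrow>
    emeasure \<kappa> A = (\<integral>\<^sup>+\<omega>. emeasure (count_space UNIV) ((\<eta> \<omega> \<times> \<eta> \<omega>) \<inter> A) \<partial>M)"
  unfolding \<kappa>_def by (rule emeasure_mean_measure[OF pairs_measurable])

lemma nn_integral_\<kappa>:
  "f \<in> borel_measurable (borel \<Otimes>\<^sub>M borel) \<Longrightarrow>
    (\<integral>\<^sup>+p. f p \<partial>\<kappa>) = (\<integral>\<^sup>+\<omega>. \<integral>\<^sup>+p. f p \<partial>count_space (\<eta> \<omega> \<times> \<eta> \<omega>) \<partial>M)"
  unfolding \<kappa>_def by (rule nn_integral_mean_measure[OF _ pairs_measurable]) (simp_all add: space_pair_measure)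

lemma emeasure_\<kappa>_square:
  assumes "B \<in> sets borel" "bounded B"
  shows "emeasure \<kappa> (B \<times> B) = (\<integral>\<^sup>+\<omega>. (points_in (\<eta> \<omega>) B)\<^sup>2 \<partial>M)"
    and "emeasure \<kappa> (B \<times> B) < \<infinity>"
proof -
  show "emeasure \<kappa> (B \<times> B) = (\<integral>\<^sup>+\<omega>. (points_in (\<eta> \<omega>) B)\<^sup>2 \<partial>M)"
    using assms by (subst emeasure_\<kappa>)
      (auto intro!: nn_integral_cong simp: emeasure_count_space_times_bounded loc_finite_\<eta> power2_eq_square)
  then show "emeasure \<kappa> (B \<times> B) < \<infinity>"
    using lsi assms by (simp add: loc_square_integrable_def)
qed

text \<open>Prepares Fubini's theorem in the averaging step; squares of balls have finite mass by
  local square integrability.\<close>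

lemma sigma_finite_\<kappa>: "sigma_finite_measure \<kappa>"
proof
  let ?A = "range (\<lambda>m::nat. cball (0 :: real ^ 'd) (real m) \<times> cball (0 :: real ^ 'd) (real m))"
  have "\<Union> ?A = UNIV"
  proof (safe, simp_all)
    fix x y :: "real ^ 'd"
    show "\<exists>m::nat. norm x \<le> real m \<and> norm y \<le> real m"
      using real_arch_simple[of "max (norm x) (norm y)"] by auto
  qed
  moreover have "emeasure \<kappa> a \<noteq> \<infinity>" if "a \<in> ?A" for a
    using that emeasure_\<kappa>_square(2) by (auto simp: less_top)
  ultimately show "\<exists>A. countable A \<and> A \<subseteq> sets \<kappa> \<and> \<Union> A = space \<kappa> \<and> (\<forall>a\<in>A. emeasure \<kappa> a \<noteq> \<infinity>)"
    by (intro exI[of _ ?A]) (auto simp: sets_\<kappa> space_\<kappa>)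
qed

lemma measurable_\<kappa>: "measurable \<kappa> N = measurable (borel \<Otimes>\<^sub>M borel) N"
  by (rule measurable_cong_sets[OF sets_\<kappa> refl])

text \<open>Summing over translated pairs of \<open>\<eta>\<close> is summing over pairs of the
  translated configuration, whose law is the same.\<close>

lemma \<kappa>_shift_invariant:
  assumes "f \<in> borel_measurable \<kappa>"
  shows "(\<integral>\<^sup>+p. f (fst p + t, snd p + t) \<partial>\<kappa>) = (\<integral>\<^sup>+p. f p \<partial>\<kappa>)"
proof -
  have f [measurable]: "f \<in> borel_measurable (borel \<Otimes>\<^sub>M borel)"
    using assms unfolding measurable_\<kappa> .
  let ?G = "\<lambda>\<phi>. \<integral>\<^sup>+p. f p \<partial>count_space (\<phi> \<times> \<phi>)"
  have G: "?G \<in> borel_measurable config_space"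
    by (rule nn_integral_random_set_measurable[OF _ emeasure_count_space_pairs_measurable f])
      (simp_all add: space_pair_measure)
  have "(\<integral>\<^sup>+p. f (fst p + t, snd p + t) \<partial>\<kappa>)
      = (\<integral>\<^sup>+\<omega>. \<integral>\<^sup>+p. f (fst p + t, snd p + t) \<partial>count_space (\<eta> \<omega> \<times> \<eta> \<omega>) \<partial>M)"
    by (rule nn_integral_\<kappa>) measurable
  also have "\<dots> = (\<integral>\<^sup>+\<omega>. ?G (shift t (\<eta> \<omega>)) \<partial>M)"
    by (intro nn_integral_cong nn_integral_bij_count_space bij_betwI') (auto simp: shift_def)
  also have "\<dots> = (\<integral>\<^sup>+\<omega>. ?G (\<eta> \<omega>) \<partial>M)"
    by (rule stationary_nn_integral[OF pp stat G])
  also have "\<dots> = (\<integral>\<^sup>+p. f p \<partial>\<kappa>)"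
    by (rule nn_integral_\<kappa>[symmetric]) measurable
  finally show ?thesis .
qed

text \<open>A refined Campbell formula for pairs: the location of a pair is integrated out against
  Lebesgue measure, and only pairs whose first point lies in the unit cube remain.\<close>

lemma \<kappa>_averaging:
  assumes [measurable]: "f \<in> borel_measurable (borel \<Otimes>\<^sub>M borel)"
  shows "(\<integral>\<^sup>+p. f p \<partial>\<kappa>)
    = (\<integral>\<^sup>+p. indicator unit_cube (fst p) * (\<integral>\<^sup>+t. f (fst p - t, snd p - t) \<partial>lborel) \<partial>\<kappa>)"
proof -
  have "(\<integral>\<^sup>+p. f p \<partial>\<kappa>)
    = (\<integral>\<^sup>+p. indicator unit_cube (fst p) * (\<integral>\<^sup>+t. f (fst p + - t, snd p + - t) \<partial>lborel) \<partial>\<kappa>)"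
  proof (rule nn_integral_averaging[where pos = fst and act = "\<lambda>t p. (fst p + t, snd p + t)" and C = unit_cube, OF sigma_finite_\<kappa>])
    show "(\<integral>\<^sup>+b. f (fst b + t, snd b + t) \<partial>\<kappa>) = integral\<^sup>N \<kappa> f" if "f \<in> borel_measurable \<kappa>" for t f
      using that by (rule \<kappa>_shift_invariant)
    have "fst \<in> borel \<Otimes>\<^sub>M borel \<rightarrow>\<^sub>M borel" by measurable
    then show "fst \<in> borel_measurable \<kappa>" by measurable
    show "(\<lambda>(t, p). (fst p + t, snd p + t)) \<in> measurable (lborel \<Otimes>\<^sub>M \<kappa>) \<kappa>"
      by (simp add: case_prod_beta measurable_cong_sets[OF refl sets_\<kappa>])
  qed (auto simp: emeasure_unit_cube)
  then show ?thesis by simp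
qed

lemma mean_points_in_eq_\<kappa>:
  assumes W: "W \<in> sets borel"
  shows "(\<integral>\<^sup>+\<omega>. points_in (\<eta> \<omega>) W \<partial>M) = emeasure \<kappa> {p. fst p = snd p \<and> fst p \<in> W}"
proof -
  have "emeasure \<kappa> {p. fst p = snd p \<and> fst p \<in> W} = (\<integral>\<^sup>+p. indicator {p. fst p = snd p \<and> fst p \<in> W} p * 1 \<partial>\<kappa>)"
    using diagonal_sets[OF W] by (simp add: sets_\<kappa>)
  also have "\<dots> = (\<integral>\<^sup>+\<omega>. \<integral>\<^sup>+x. indicator W x * 1 \<partial>count_space (\<eta> \<omega>) \<partial>M)"
    using diagonal_sets[OF W] by (subst nn_integral_\<kappa>) (auto simp del: mult_1_right simp: nn_integral_count_space_diagonal)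
  also have "\<dots> = (\<integral>\<^sup>+\<omega>. points_in (\<eta> \<omega>) W \<partial>M)"
    by (simp add: nn_integral_indicator_count_space points_in_def)
  finally show ?thesis ..
qed

text \<open>Averaging the indicator of the diagonal over \<open>W\<close>: the inner integral is the
  volume of \<open>W\<close>, and the mass left over is that of the diagonal over the unit cube,
  which is the intensity.\<close>

lemma mean_points_in:
  assumes [measurable]: "W \<in> sets borel"
  shows "(\<integral>\<^sup>+\<omega>. points_in (\<eta> \<omega>) W \<partial>M) = ennreal \<gamma> * emeasure lborel W"
proof -
  let ?D = "\<lambda>W. {p :: (real ^ 'd) \<times> (real ^ 'd). fst p = snd p \<and> fst p \<in> W}"
  note [measurable] = diagonal_sets[OF assms]
  have W': "(\<integral>\<^sup>+t. indicator W (x - t) \<partial>lborel) = emeasure lborel W" for x :: "real ^ 'd"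
    by (subst nn_integral_lborel_reflect) auto
  have "(\<integral>\<^sup>+\<omega>. points_in (\<eta> \<omega>) W \<partial>M) = (\<integral>\<^sup>+p. indicator (?D W) p \<partial>\<kappa>)"
    by (simp add: mean_points_in_eq_\<kappa> sets_\<kappa>)
  also have "\<dots> = (\<integral>\<^sup>+p. indicator unit_cube (fst p) * (\<integral>\<^sup>+t. indicator (?D W) (fst p - t, snd p - t) \<partial>lborel) \<partial>\<kappa>)"
    by (rule \<kappa>_averaging) measurable
  also have "\<dots> = (\<integral>\<^sup>+p. emeasure lborel W * indicator (?D unit_cube) p \<partial>\<kappa>)"
  proof (rule nn_integral_cong)
    fix p :: "(real ^ 'd) \<times> (real ^ 'd)"
    show "indicator unit_cube (fst p) * (\<integral>\<^sup>+t. indicator (?D W) (fst p - t, snd p - t) \<partial>lborel)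
        = emeasure lborel W * indicator (?D unit_cube) p"
    proof (cases "fst p = snd p")
      case True
      then have "indicator (?D W) (fst p - t, snd p - t) = (indicator W (fst p - t) :: ennreal)" for t
        by (simp add: indicator_def)
      moreover have "indicator (?D unit_cube) p = (indicator unit_cube (fst p) :: ennreal)"
        using True by (simp add: indicator_def)
      ultimately show ?thesis by (simp add: W' mult.commute)
    qed (simp add: indicator_def)
  qed
  also have "\<dots> = emeasure lborel W * emeasure \<kappa> (?D unit_cube)"
    using diagonal_sets[OF unit_cube_sets] by (subst nn_integral_cmult_indicator) (auto simp: sets_\<kappa>)
  also have "emeasure \<kappa> (?D unit_cube) = ennreal \<gamma>"
    using mean_points_in_eq_\<kappa>[OF unit_cube_sets] int by (simp add: intensity_def)
  finally show ?thesis by (simp add: mult.commute)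
qed

section \<open>The reduced second factorial moment measure and the bound on second moments\<close>

lemma off_diagonal_sets [measurable]:
  "{p. fst p \<noteq> snd p} \<in> sets (borel \<Otimes>\<^sub>M (borel :: (real ^ 'd) measure))"
proof -
  have "{p \<in> space (borel \<Otimes>\<^sub>M (borel :: (real ^ 'd) measure)). fst p \<noteq> snd p} \<in> sets (borel \<Otimes>\<^sub>M borel)"
    by measurable
  then show ?thesis by (simp add: space_pair_measure)
qed

text \<open>The set function \<open>red_fact_moment\<close> realized as an object of measure type,
  so that functions can be integrated against it.\<close>

definition \<alpha> :: "(real ^ 'd) measure" where
  "\<alpha> = distr (density \<kappa> (\<lambda>p. indicator unit_cube (fst p) * indicator {p. fst p \<noteq> snd p} p)) borel (\<lambda>p. snd p - fst p)"

lemma sets_\<alpha> [measurable_cong]: "sets \<alpha> = sets borel"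
  by (simp add: \<alpha>_def)

lemma nn_integral_\<alpha>:
  assumes [measurable]: "f \<in> borel_measurable borel"
  shows "(\<integral>\<^sup>+z. f z \<partial>\<alpha>)
    = (\<integral>\<^sup>+p. indicator unit_cube (fst p) * indicator {p. fst p \<noteq> snd p} p * f (snd p - fst p) \<partial>\<kappa>)"
  unfolding \<alpha>_def by (subst nn_integral_distr) (auto simp: nn_integral_density)

lemma emeasure_\<alpha>:
  assumes [measurable]: "B \<in> sets borel"
  shows "emeasure \<alpha> B = red_fact_moment M \<eta> B"
proof -
  let ?E = "{p. fst p \<in> unit_cube \<and> fst p \<noteq> snd p \<and> snd p - fst p \<in> B}"
  have "{p \<in> space (borel \<Otimes>\<^sub>M (borel :: (real ^ 'd) measure)). fst p \<in> unit_cube \<and> fst p \<noteq> snd p \<and> snd p - fst p \<in> B} \<in> sets (borel \<Otimes>\<^sub>M borel)"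
    by measurable
  then have E: "?E \<in> sets (borel \<Otimes>\<^sub>M borel)" by (simp add: space_pair_measure)
  have "emeasure \<alpha> B = (\<integral>\<^sup>+z. indicator B z \<partial>\<alpha>)"
    by (simp add: sets_\<alpha>)
  also have "\<dots> = (\<integral>\<^sup>+p. indicator ?E p \<partial>\<kappa>)"
    by (subst nn_integral_\<alpha>) (auto intro!: nn_integral_cong split: split_indicator)
  also have "\<dots> = emeasure \<kappa> ?E"
    using E by (simp add: sets_\<kappa>)
  also have "\<dots> = red_fact_moment M \<eta> B"
    unfolding emeasure_\<kappa>[OF E] red_fact_moment_def
    by (intro nn_integral_cong arg_cong[where f = "emeasure _"]) auto
  finally show ?thesis .
qed

lemma emeasure_\<alpha>_finite:
  assumes [measurable]: "B \<in> sets borel" and "bounded B"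
  shows "emeasure \<alpha> B < \<infinity>"
proof -
  obtain R where R: "\<And>x. x \<in> B \<Longrightarrow> norm x \<le> R"
    using \<open>bounded B\<close> by (auto simp: bounded_iff)
  have "bounded (unit_cube :: (real ^ 'd) set)"
    by (simp add: unit_cube_def bounded_cbox)
  then obtain S where S: "\<And>x :: real ^ 'd. x \<in> unit_cube \<Longrightarrow> norm x \<le> S"
    by (auto simp: bounded_iff)
  \<comment> \<open>Radius \<open>S\<close> catches the first point, which lies in the unit cube;
    \<open>R + S\<close> catches the second, whose difference from the first lies in
    \<open>B\<close>.\<close>
  let ?V = "cball 0 (max S (R + S)) :: (real ^ 'd) set"
  have "emeasure \<alpha> B = (\<integral>\<^sup>+z. indicator B z \<partial>\<alpha>)"
    by (simp add: sets_\<alpha>)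
  also have "\<dots> \<le> (\<integral>\<^sup>+p. indicator (?V \<times> ?V) p \<partial>\<kappa>)"
  proof (subst nn_integral_\<alpha>, simp, intro nn_integral_mono)
    fix p :: "(real ^ 'd) \<times> (real ^ 'd)"
    have "p \<in> ?V \<times> ?V" if "fst p \<in> unit_cube" "snd p - fst p \<in> B"
    proof -
      have "norm (snd p) \<le> norm (snd p - fst p) + norm (fst p)"
        using norm_triangle_ineq[of "snd p - fst p" "fst p"] by simp
      with R[OF that(2)] S[OF that(1)] show ?thesis
        by (cases p) auto
    qed
    then show "indicator unit_cube (fst p) * indicator {p. fst p \<noteq> snd p} p * indicator B (snd p - fst p)
        \<le> (indicator (?V \<times> ?V) p :: ennreal)"
      by (auto split: split_indicator)
  qed
  also have "\<dots> = emeasure \<kappa> (?V \<times> ?V)"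
    by (simp add: sets_\<kappa>)
  also have "\<dots> < \<infinity>"
    by (rule emeasure_\<kappa>_square) auto
  finally show ?thesis .
qed

lemma beta2_eq: "B \<in> sets borel \<Longrightarrow> beta2 \<gamma> M \<eta> B = measure \<alpha> B - \<gamma>\<^sup>2 * measure lborel B"
  by (simp add: beta2_def measure_def emeasure_\<alpha>)

text \<open>Supplies the additivity that \<open>emeasure_upper_variation\<close> asks for.
  Boundedness of the union makes both measures finite there, so the difference of the two real
  series is legitimate.\<close>

lemma beta2_sums:
  fixes A :: "nat \<Rightarrow> (real ^ 'd) set"
  assumes "range A \<subseteq> sets borel" "disjoint_family A" "bounded (\<Union>i. A i)"
  shows "(\<lambda>i. beta2 \<gamma> M \<eta> (A i)) sums beta2 \<gamma> M \<eta> (\<Union>i. A i)"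
proof -
  have U: "(\<Union>i. A i) \<in> sets borel" using assms(1) by auto
  have "(\<lambda>i. measure \<alpha> (A i)) sums measure \<alpha> (\<Union>i. A i)"
    using assms emeasure_\<alpha>_finite[OF U] by (intro measure_UNION) (auto simp: sets_\<alpha>)
  moreover have "(\<lambda>i. measure lborel (A i)) sums measure lborel (\<Union>i. A i)"
    using assms emeasure_bounded_finite[OF assms(3)] by (intro measure_UNION) auto
  ultimately have "(\<lambda>i. measure \<alpha> (A i) - \<gamma>\<^sup>2 * measure lborel (A i)) sums
      (measure \<alpha> (\<Union>i. A i) - \<gamma>\<^sup>2 * measure lborel (\<Union>i. A i))"
    by (intro sums_diff sums_mult)
  then show ?thesis
    using assms(1) U by (simp add: beta2_eq subset_iff range_subsetD)
qed

text \<open>On a bounded set, \<open>\<alpha>\<close> is \<open>beta2\<close> plus \<gamma>^2 times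
  Lebesgue measure, and \<open>beta2\<close> is one of the competitors in the supremum defining the
  upper variation. General sets are exhausted by their intersections with balls.\<close>

lemma emeasure_\<alpha>_le:
  assumes A: "A \<in> sets borel"
  shows "emeasure \<alpha> A \<le> ennreal (\<gamma>\<^sup>2) * emeasure lborel A + emeasure (upper_variation (beta2 \<gamma> M \<eta>)) A"
proof -
  let ?u = "upper_variation (beta2 \<gamma> M \<eta>)"
  let ?V = "\<lambda>m::nat. A \<inter> cball 0 (real m)"
  have V: "?V m \<in> sets borel" "bounded (?V m)" for m
    using A by (auto intro: bounded_subset[OF bounded_cball])
  have eu: "emeasure ?u A = (SUP B \<in> {B \<in> sets borel. bounded B \<and> B \<subseteq> A}. ennreal (beta2 \<gamma> M \<eta> B))"
    using A by (intro emeasure_upper_variation beta2_sums)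
  have le: "emeasure \<alpha> (?V m) \<le> ennreal (\<gamma>\<^sup>2) * emeasure lborel A + emeasure ?u A" for m
  proof -
    have "emeasure \<alpha> (?V m) = ennreal (measure \<alpha> (?V m))"
      using emeasure_\<alpha>_finite[OF V(1,2), of m] by (intro emeasure_eq_ennreal_measure) (simp add: less_top)
    also have "measure \<alpha> (?V m) = beta2 \<gamma> M \<eta> (?V m) + \<gamma>\<^sup>2 * measure lborel (?V m)"
      using V by (simp add: beta2_eq)
    also have "ennreal \<dots> \<le> ennreal (beta2 \<gamma> M \<eta> (?V m)) + ennreal (\<gamma>\<^sup>2 * measure lborel (?V m))"
      \<comment> \<open>A negative value of \<open>beta2\<close> is truncated to 0 by
        \<open>ennreal\<close>, which only enlarges the right-hand side.\<close>
      by (cases "0 \<le> beta2 \<gamma> M \<eta> (?V m)") (auto simp: ennreal_neg intro!: ennreal_leI simp flip: ennreal_plus)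
    also have "ennreal (\<gamma>\<^sup>2 * measure lborel (?V m)) = ennreal (\<gamma>\<^sup>2) * emeasure lborel (?V m)"
    proof -
      have "emeasure lborel (?V m) \<noteq> top"
        using emeasure_bounded_finite[OF V(2), of m] by (simp add: less_top)
      then show ?thesis
        by (simp add: emeasure_eq_ennreal_measure ennreal_mult)
    qed
    also have "ennreal (beta2 \<gamma> M \<eta> (?V m)) \<le> emeasure ?u A"
      unfolding eu using V by (intro SUP_upper) auto
    also have "emeasure lborel (?V m) \<le> emeasure lborel A"
      using A by (intro emeasure_mono) auto
    finally show ?thesis
      by (simp add: add.commute add_left_mono mult_left_mono)
  qed
  have "(SUP m. emeasure \<alpha> (?V m)) = emeasure \<alpha> (\<Union>m. ?V m)"
    using V by (intro SUP_emeasure_incseq) (auto simp: incseq_def sets_\<alpha>)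
  moreover have "(\<Union>m. ?V m) = A"
    using real_arch_simple by auto
  ultimately have "emeasure \<alpha> A = (SUP m. emeasure \<alpha> (?V m))"
    by (simp only:)
  then show ?thesis
    using SUP_least[of UNIV, OF le] by (simp only:)
qed

text \<open>The squared count is the number of pairs in \<open>W \<times> W\<close>. The diagonal
  contributes the mean. Averaging turns the other pairs into the integral of \<open>g\<close>
  against \<open>\<alpha>\<close>; under the domination of \<open>\<alpha>\<close>, the Lebesgue
  part uses the total integral of \<open>g\<close> and the variation part its maximal size.\<close>

lemma second_moment_le:
  assumes W [measurable]: "W \<in> sets borel" and "bounded W"
  shows "(\<integral>\<^sup>+\<omega>. (points_in (\<eta> \<omega>) W)\<^sup>2 \<partial>M)
    \<le> ennreal \<gamma> * emeasure lborel W + ennreal (\<gamma>\<^sup>2) * (emeasure lborel W)\<^sup>2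
      + emeasure lborel W * emeasure (upper_variation (beta2 \<gamma> M \<eta>)) UNIV"
proof -
  let ?u = "upper_variation (beta2 \<gamma> M \<eta>)"
  let ?o = "\<lambda>p. indicator {p :: (real ^ 'd) \<times> (real ^ 'd). fst p \<noteq> snd p} p :: ennreal"
  \<comment> \<open>The covariogram of \<open>W\<close>: the volume of the intersection of
    \<open>W\<close> with its translate by \<open>-z\<close>.\<close>
  define g :: "real ^ 'd \<Rightarrow> ennreal" where
    "g z = (\<integral>\<^sup>+s. indicator W s * indicator W (s + z) \<partial>lborel)" for z
  have [measurable]: "(\<lambda>x. indicator W (fst x) * indicator W (fst x + snd x) :: ennreal) \<in> borel_measurable (lborel \<Otimes>\<^sub>M lborel)"
    "(\<lambda>x. indicator W (snd x) * indicator W (snd x + fst x) :: ennreal) \<in> borel_measurable (borel \<Otimes>\<^sub>M lborel)"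
    by measurable
  have g [measurable]: "g \<in> borel_measurable borel"
    unfolding g_def using lborel.borel_measurable_nn_integral[of "\<lambda>z s. indicator W s * indicator W (s + z)" borel]
    by (simp add: case_prod_beta)
  have g_le: "g z \<le> emeasure lborel W" for z
  proof -
    have "g z \<le> (\<integral>\<^sup>+s. indicator W s \<partial>lborel)"
      unfolding g_def by (intro nn_integral_mono) (auto split: split_indicator)
    then show ?thesis by simp
  qed
  have g_int: "(\<integral>\<^sup>+z. g z \<partial>lborel) = (emeasure lborel W)\<^sup>2"
  proof -
    have W': "(\<integral>\<^sup>+z. indicator W (s + z) \<partial>lborel) = emeasure lborel W" for s :: "real ^ 'd"
    proof -
      have "(\<integral>\<^sup>+z. indicator W (s + z) \<partial>lborel) = (\<integral>\<^sup>+z. indicator W z \<partial>distr lborel borel ((+) s))"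
        by (subst nn_integral_distr) auto
      then show ?thesis by (simp add: lborel_distr_plus)
    qed
    have "(\<integral>\<^sup>+z. g z \<partial>lborel) = (\<integral>\<^sup>+s. \<integral>\<^sup>+z. indicator W s * indicator W (s + z) \<partial>lborel \<partial>lborel)"
      unfolding g_def by (rule lborel_pair.Fubini') (simp add: case_prod_beta)
    also have "\<dots> = (\<integral>\<^sup>+s. emeasure lborel W * indicator W s \<partial>lborel)"
      by (simp add: nn_integral_cmult W' mult.commute)
    also have "\<dots> = (emeasure lborel W)\<^sup>2"
      by (simp add: nn_integral_cmult_indicator power2_eq_square)
    finally show ?thesis .
  qed
  have "(\<integral>\<^sup>+\<omega>. (points_in (\<eta> \<omega>) W)\<^sup>2 \<partial>M) = emeasure \<kappa> (W \<times> W)"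
    using assms by (simp add: emeasure_\<kappa>_square)
  also have "\<dots> = (\<integral>\<^sup>+p. indicator (W \<times> W) p \<partial>\<kappa>)"
    by (rule nn_integral_indicator[symmetric]) (simp add: sets_\<kappa>)
  also have "\<dots> = (\<integral>\<^sup>+p. indicator {p. fst p = snd p \<and> fst p \<in> W} p
      + ?o p * (indicator W (fst p) * indicator W (snd p)) \<partial>\<kappa>)"
    by (intro nn_integral_cong) (auto simp: indicator_def)
  also have "\<dots> = (\<integral>\<^sup>+p. indicator {p. fst p = snd p \<and> fst p \<in> W} p \<partial>\<kappa>)
      + (\<integral>\<^sup>+p. ?o p * (indicator W (fst p) * indicator W (snd p)) \<partial>\<kappa>)"
    using diagonal_sets[OF W] by (intro nn_integral_add) auto
  also have "(\<integral>\<^sup>+p. indicator {p. fst p = snd p \<and> fst p \<in> W} p \<partial>\<kappa>) = ennreal \<gamma> * emeasure lborel W"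
    using diagonal_sets[OF W] by (simp add: sets_\<kappa> mean_points_in_eq_\<kappa>[OF W, symmetric] mean_points_in)
  also have "(\<integral>\<^sup>+p. ?o p * (indicator W (fst p) * indicator W (snd p)) \<partial>\<kappa>)
      = (\<integral>\<^sup>+p. indicator unit_cube (fst p) *
          (\<integral>\<^sup>+t. ?o (fst p - t, snd p - t) * (indicator W (fst p - t) * indicator W (snd p - t)) \<partial>lborel) \<partial>\<kappa>)"
    by (subst \<kappa>_averaging) auto
  also have "\<dots> = (\<integral>\<^sup>+p. indicator unit_cube (fst p) * ?o p * g (snd p - fst p) \<partial>\<kappa>)"
  proof (intro nn_integral_cong)
    fix p :: "(real ^ 'd) \<times> (real ^ 'd)"
    have "g (snd p - fst p) = (\<integral>\<^sup>+t. indicator W (fst p - t) * indicator W (fst p - t + (snd p - fst p)) \<partial>lborel)"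
      unfolding g_def by (rule nn_integral_lborel_reflect[symmetric]) measurable
    also have "\<dots> = (\<integral>\<^sup>+t. indicator W (fst p - t) * indicator W (snd p - t) \<partial>lborel)"
      by simp
    finally have "(\<integral>\<^sup>+t. ?o (fst p - t, snd p - t) * (indicator W (fst p - t) * indicator W (snd p - t)) \<partial>lborel)
        = ?o p * g (snd p - fst p)"
      by (cases "fst p = snd p") simp_all
    then show "indicator unit_cube (fst p) *
          (\<integral>\<^sup>+t. ?o (fst p - t, snd p - t) * (indicator W (fst p - t) * indicator W (snd p - t)) \<partial>lborel)
        = indicator unit_cube (fst p) * ?o p * g (snd p - fst p)"
      by (simp add: mult.assoc)
  qed
  also have "\<dots> = (\<integral>\<^sup>+z. g z \<partial>\<alpha>)"
    by (subst nn_integral_\<alpha>) auto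
  also have "\<dots> \<le> (\<integral>\<^sup>+z. g z \<partial>density lborel (\<lambda>_. ennreal (\<gamma>\<^sup>2))) + (\<integral>\<^sup>+z. g z \<partial>?u)"
  proof (rule nn_integral_le_add)
    fix A assume "A \<in> sets \<alpha>"
    then have "A \<in> sets borel" by (simp add: sets_\<alpha>)
    then show "emeasure \<alpha> A \<le> emeasure (density lborel (\<lambda>_. ennreal (\<gamma>\<^sup>2))) A + emeasure ?u A"
      using emeasure_\<alpha>_le[of A] by (simp add: emeasure_density_const)
  qed (auto simp: sets_\<alpha> sets_upper_variation)
  also have "(\<integral>\<^sup>+z. g z \<partial>density lborel (\<lambda>_. ennreal (\<gamma>\<^sup>2))) = ennreal (\<gamma>\<^sup>2) * (emeasure lborel W)\<^sup>2"
    by (simp add: nn_integral_density nn_integral_cmult g_int)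
  also have "(\<integral>\<^sup>+z. g z \<partial>?u) \<le> (\<integral>\<^sup>+z. emeasure lborel W \<partial>?u)"
    by (intro nn_integral_mono g_le)
  also have "\<dots> = emeasure lborel W * emeasure ?u UNIV"
    using sets_eq_imp_space_eq[OF sets_upper_variation[of "beta2 \<gamma> M \<eta>"]] by simp
  finally show ?thesis
    by (simp add: add.assoc add_left_mono)
qed

section \<open>Convergence in probability of the empirical intensity\<close>

lemma points_in_eq_card:
  assumes "\<omega> \<in> space M" "bounded W"
  shows "points_in (\<eta> \<omega>) W = ennreal (real (card (\<eta> \<omega> \<inter> W)))"
  using assms loc_finite_\<eta>[OF assms(1)]
  by (simp add: points_in_def loc_finite_def ennreal_of_nat_eq_real_of_nat)

lemma card_measurable:
  assumes [measurable]: "W \<in> sets borel" and "bounded W"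
  shows "(\<lambda>\<omega>. real (card (\<eta> \<omega> \<inter> W))) \<in> borel_measurable M"
proof (subst measurable_cong)
  show "real (card (\<eta> \<omega> \<inter> W)) = enn2real (points_in (\<eta> \<omega>) W)" if "\<omega> \<in> space M" for \<omega>
    using that assms(2) by (simp add: points_in_eq_card)
qed (use points_in_measurable in measurable)

lemma density_tendsto_intensity:
  assumes uv: "emeasure (upper_variation (beta2 \<gamma> M \<eta>)) UNIV < \<infinity>" and "\<epsilon> > 0"
  shows "((\<lambda>r. prob {\<omega> \<in> space M. \<epsilon> \<le> \<bar>real (card (\<eta> \<omega> \<inter> window r)) / r ^ CARD('d) - \<gamma>\<bar>}) \<longlongrightarrow> 0) at_top"
proof -
  obtain c where c: "c \<ge> 0" "emeasure (upper_variation (beta2 \<gamma> M \<eta>)) UNIV = ennreal c"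
    using uv by (cases "emeasure (upper_variation (beta2 \<gamma> M \<eta>)) UNIV") auto
  have bound: "prob {\<omega> \<in> space M. \<epsilon> \<le> \<bar>real (card (\<eta> \<omega> \<inter> window r)) / r ^ CARD('d) - \<gamma>\<bar>}
      \<le> (\<gamma> + c) / \<epsilon>\<^sup>2 / r ^ CARD('d)" if "r > 0" for r
  proof -
    define L where "L = r ^ CARD('d)"
    have L: "L > 0" using that by (simp add: L_def)
    define X where "X \<omega> = real (card (\<eta> \<omega> \<inter> window r))" for \<omega>
    have X [measurable]: "X \<in> borel_measurable M"
      unfolding X_def[abs_def] by (intro card_measurable window_sets bounded_window)
    have X_nonneg: "X \<omega> \<ge> 0" for \<omega> by (simp add: X_def)
    have eL: "emeasure lborel (window r :: (real ^ 'd) set) = ennreal L"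
      using that by (simp add: emeasure_window L_def)
    have "(\<integral>\<^sup>+\<omega>. ennreal (X \<omega>) \<partial>M) = (\<integral>\<^sup>+\<omega>. points_in (\<eta> \<omega>) (window r) \<partial>M)"
      by (intro nn_integral_cong) (simp add: points_in_eq_card bounded_window X_def)
    also have "\<dots> = ennreal (\<gamma> * L)"
      using mean_points_in[OF window_sets, of r] L \<gamma>_nonneg by (simp add: eL ennreal_mult)
    finally have EX: "expectation X = \<gamma> * L"
      using L \<gamma>_nonneg X_nonneg by (intro integral_eq_nn_integral[THEN trans]) auto
    have "(\<integral>\<^sup>+\<omega>. ennreal ((X \<omega>)\<^sup>2) \<partial>M) = (\<integral>\<^sup>+\<omega>. (points_in (\<eta> \<omega>) (window r))\<^sup>2 \<partial>M)"
      by (intro nn_integral_cong) (simp add: points_in_eq_card bounded_window X_def ennreal_power)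
    also have "\<dots> \<le> ennreal \<gamma> * ennreal L + ennreal (\<gamma>\<^sup>2) * (ennreal L)\<^sup>2 + ennreal L * ennreal c"
      using second_moment_le[OF window_sets bounded_window, of r] by (simp add: eL c)
    also have "\<dots> = ennreal (\<gamma> * L + \<gamma>\<^sup>2 * L\<^sup>2 + L * c)"
      using L \<gamma>_nonneg c(1) by (simp add: ennreal_mult ennreal_power ennreal_plus)
    finally have sq: "(\<integral>\<^sup>+\<omega>. ennreal ((X \<omega>)\<^sup>2) \<partial>M) \<le> ennreal (\<gamma> * L + \<gamma>\<^sup>2 * L\<^sup>2 + L * c)" .
    have i2: "integrable M (\<lambda>\<omega>. (X \<omega>)\<^sup>2)"
      using sq by (intro integrableI_nonneg) (auto simp: less_top[symmetric] top_unique)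
    have E2: "expectation (\<lambda>\<omega>. (X \<omega>)\<^sup>2) \<le> \<gamma> * L + \<gamma>\<^sup>2 * L\<^sup>2 + L * c"
    proof -
      have "ennreal (expectation (\<lambda>\<omega>. (X \<omega>)\<^sup>2)) \<le> ennreal (\<gamma> * L + \<gamma>\<^sup>2 * L\<^sup>2 + L * c)"
        using sq i2 by (simp add: nn_integral_eq_integral)
      then show ?thesis using L \<gamma>_nonneg c(1) by (subst (asm) ennreal_le_iff) auto
    qed
    have "variance X = expectation (\<lambda>\<omega>. (X \<omega>)\<^sup>2) - (expectation X)\<^sup>2"
      using i2 X by (intro variance_eq) (auto intro: square_integrable_imp_integrable)
    \<comment> \<open>The term \<gamma>^2 L^2 of the second moment cancels against the squared mean,
      leaving a bound linear in the volume \<open>L\<close>.\<close>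
    then have var: "variance X \<le> L * (\<gamma> + c)"
      using E2 by (simp add: EX power_mult_distrib algebra_simps)
    have "{\<omega> \<in> space M. \<epsilon> \<le> \<bar>X \<omega> / L - \<gamma>\<bar>} = {\<omega> \<in> space M. \<epsilon> * L \<le> \<bar>X \<omega> - expectation X\<bar>}"
    proof -
      have "\<bar>X \<omega> / L - \<gamma>\<bar> = \<bar>X \<omega> - \<gamma> * L\<bar> / L" for \<omega>
      proof -
        have "X \<omega> / L - \<gamma> = (X \<omega> - \<gamma> * L) / L" using L by (simp add: field_simps)
        then show ?thesis using L by simp
      qed
      then show ?thesis using L by (simp add: EX pos_le_divide_eq)
    qed
    then have "prob {\<omega> \<in> space M. \<epsilon> \<le> \<bar>X \<omega> / L - \<gamma>\<bar>} \<le> variance X / (\<epsilon> * L)\<^sup>2"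
      using Chebyshev_inequality[OF X i2, of "\<epsilon> * L"] L \<open>\<epsilon> > 0\<close> by simp
    also have "\<dots> \<le> L * (\<gamma> + c) / (\<epsilon> * L)\<^sup>2"
      by (intro divide_right_mono var) simp
    also have "\<dots> = (\<gamma> + c) / \<epsilon>\<^sup>2 / L"
      using L by (simp add: power2_eq_square)
    finally show ?thesis by (simp add: X_def L_def)
  qed
  \<comment> \<open>The power tends to infinity because the dimension, as the cardinality of a
    finite type, is at least 1.\<close>
  have "((\<lambda>r :: real. (\<gamma> + c) / \<epsilon>\<^sup>2 / r ^ CARD('d)) \<longlongrightarrow> 0) at_top"
    by (intro tendsto_divide_0[OF tendsto_const] filterlim_at_top_imp_at_infinity filterlim_pow_at_top filterlim_ident) simp
  then show ?thesis
  proof (rule tendsto_sandwich[rotated -1])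
    show "\<forall>\<^sub>F r in at_top. prob {\<omega> \<in> space M. \<epsilon> \<le> \<bar>real (card (\<eta> \<omega> \<inter> window r)) / r ^ CARD('d) - \<gamma>\<bar>}
      \<le> (\<gamma> + c) / \<epsilon>\<^sup>2 / r ^ CARD('d)"
      using eventually_gt_at_top[of 0] by eventually_elim (rule bound)
    show "((\<lambda>r. 0) \<longlongrightarrow> 0) at_top" by (rule tendsto_const)
  qed simp
qed

end

section \<open>Slutsky's theorem for tuples\<close>

text \<open>Tychonoff's theorem for a product of closed balls. It supplies the compact sets on which
  test functions of sequences are uniformly continuous.\<close>

lemma compact_bounded_functions:
  fixes K :: real
  shows "compact {x :: 'i \<Rightarrow> 'b::{real_normed_vector, heine_borel}. \<forall>i. norm (x i) \<le> K}"
proof -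
  have "compactin (product_topology (\<lambda>_. euclidean) UNIV) (\<Pi>\<^sub>E i\<in>(UNIV :: 'i set). cball (0 :: 'b) K)"
    unfolding compactin_PiE by simp
  moreover have "(\<Pi>\<^sub>E i\<in>(UNIV :: 'i set). cball (0 :: 'b) K) = {x. \<forall>i. norm (x i) \<le> K}"
    by (auto simp: PiE_def Pi_def)
  ultimately show ?thesis
    by (simp add: euclidean_product_topology)
qed

text \<open>Together with \<open>continuous_map_restrict_UNIV\<close> this carries test functions
  back and forth between \<open>n\<close>-tuples and sequences; \<open>c\<close> fills the
  coordinates from \<open>n\<close> on.\<close>

lemma continuous_map_truncate:
  "continuous_map (product_topology (\<lambda>_. euclidean) {..<n}) euclidean
    (\<lambda>y j. if j < n then y j else (c :: 'b::topological_space))"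
  unfolding euclidean_product_topology[symmetric]
  by (subst continuous_map_componentwise_UNIV) (auto intro: continuous_map_product_projection)

lemma continuous_map_restrict_UNIV:
  "continuous_map euclidean (product_topology (\<lambda>_. euclidean) I) (\<lambda>y :: 'i \<Rightarrow> 'b::topological_space. restrict y I)"
  unfolding continuous_map_componentwise euclidean_product_topology[symmetric]
  by (auto intro: continuous_map_product_projection)

lemma measurable_truncate:
  fixes L :: "nat \<Rightarrow> 'b::second_countable_topology measure"
  assumes "\<And>j. j < n \<Longrightarrow> sets (L j) = sets borel"
  shows "(\<lambda>y j. if j < n then y j else c) \<in> borel_measurable (\<Pi>\<^sub>M j\<in>{..<n}. L j)"
proof (rule measurable_coordinatewise_then_product)
  fix j
  show "(\<lambda>y. if j < n then y j else c) \<in> borel_measurable (\<Pi>\<^sub>M j\<in>{..<n}. L j)"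
  proof (cases "j < n")
    case True
    then have "(\<lambda>y. y j) \<in> measurable (\<Pi>\<^sub>M j\<in>{..<n}. L j) (L j)"
      by (intro measurable_component_singleton) simp
    then have "(\<lambda>y. y j) \<in> borel_measurable (\<Pi>\<^sub>M j\<in>{..<n}. L j)"
      unfolding measurable_cong_sets[OF refl assms[OF True]] .
    with True show ?thesis by (simp only: if_True)
  qed simp
qed

text \<open>The test function is extended from \<open>n\<close>-tuples to all sequences, where the
  product topology is metrizable and bounded sets are relatively compact.\<close>

lemma tuple_conv_in_distr_slutsky:
  fixes X :: "nat \<Rightarrow> real \<Rightarrow> 'w \<Rightarrow> 'b::euclidean_space"
    and g :: "real \<Rightarrow> 'b \<Rightarrow> 'c::second_countable_topology"
  assumes "prob_space M"
    and X: "\<And>j r. j < n \<Longrightarrow> X j r \<in> borel_measurable M"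
    and A [measurable]: "\<And>r. A r \<in> borel_measurable M"
    and conv: "tuple_conv_in_distr M n X L"
    and L: "\<And>j. prob_space (L j)" "\<And>j. sets (L j) = sets borel"
    and prob_conv: "\<And>\<epsilon>. \<epsilon> > 0 \<Longrightarrow>
      ((\<lambda>r. measure M {\<omega> \<in> space M. \<epsilon> \<le> \<bar>A r \<omega> - a\<bar>}) \<longlongrightarrow> 0) at_top"
    and g: "continuous_on UNIV (\<lambda>p. g (fst p) (snd p))"
  shows "tuple_conv_in_distr M n (\<lambda>j r \<omega>. g (A r \<omega>) (X j r \<omega>)) (\<lambda>j. distr (L j) borel (g a))"
  unfolding tuple_conv_in_distr_def conv_in_distr_def
proof (intro allI impI, elim conjE)
  fix f :: "(nat \<Rightarrow> 'c) \<Rightarrow> real"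
  assume f: "continuous_map (product_topology (\<lambda>_. euclidean) {..<n}) euclideanreal f"
    and bdd: "bounded (f ` topspace (product_topology (\<lambda>_. euclidean) {..<n}))"
  interpret M: prob_space M by fact
  let ?PL = "\<Pi>\<^sub>M j\<in>{..<n}. L j"
  interpret PL: prob_space ?PL by (rule prob_space_PiM) (rule L)
  obtain B where "\<And>y. y \<in> extensional {..<n} \<Longrightarrow> \<bar>f y\<bar> \<le> B" and B: "B \<ge> 0"
    using bdd by (auto simp: bounded_pos PiE_def intro: less_imp_le)
  define F where "F y = f (restrict y {..<n})" for y
  have F_le: "\<bar>F y\<bar> \<le> B" for y
    unfolding F_def by (rule \<open>\<And>y. y \<in> extensional {..<n} \<Longrightarrow> \<bar>f y\<bar> \<le> B\<close>) simp
  have F_cont: "continuous_on UNIV F"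
    using continuous_map_compose[OF continuous_map_restrict_UNIV f]
    by (simp add: F_def[abs_def] comp_def)
  have F_cong: "F y = F y'" if "\<And>j. j < n \<Longrightarrow> y j = y' j" for y y'
    unfolding F_def using that by (intro arg_cong[where f = f]) (auto simp: restrict_def)
  \<comment> \<open>The test function as a function of the untransformed tuple when the real factor
    has the value \<open>s\<close>. The task becomes replacing the random \<open>A r\<close> by its
    limit \<open>a\<close>.\<close>
  define h where "h s x = F (\<lambda>j. g s (x j))" for s and x :: "nat \<Rightarrow> 'b"
  have h_cont: "continuous_on UNIV (\<lambda>p. h (fst p) (snd p))"
  proof -
    have "continuous_on UNIV (\<lambda>p :: real \<times> (nat \<Rightarrow> 'b). (fst p, snd p j))" for j
      by (intro continuous_on_Pair continuous_on_fst continuous_on_id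
          continuous_on_product_then_coordinatewise[OF continuous_on_snd])
    then have "continuous_on UNIV (\<lambda>p :: real \<times> (nat \<Rightarrow> 'b). g (fst p) (snd p j))" for j
      using continuous_on_compose2[OF g, of UNIV "\<lambda>p. (fst p, snd p j)"] by simp
    then have "continuous_on UNIV (\<lambda>(p :: real \<times> (nat \<Rightarrow> 'b)) j. g (fst p) (snd p j))"
      by (intro continuous_on_coordinatewise_then_product)
    then show ?thesis
      unfolding h_def using continuous_on_compose2[OF F_cont] by auto
  qed
  have h_le: "\<bar>h s x\<bar> \<le> B" for s x
    by (simp add: h_def F_le)
  have h_meas: "(\<lambda>p. h (fst p) (snd p)) \<in> borel_measurable borel"
    by (rule borel_measurable_continuous_onI[OF h_cont])
  have ha_cont: "continuous_on UNIV (h s)" for s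
    using continuous_on_compose2[OF h_cont, of UNIV "\<lambda>x. (s, x)"] by (simp add: continuous_on_Pair)
  have [measurable]: "h s \<in> borel_measurable borel" for s
    by (rule borel_measurable_continuous_onI[OF ha_cont])
  let ?T = "\<lambda>y j. if j < n then y j else (0 :: 'b)"
  \<comment> \<open>Padding by 0 keeps the additional coordinates inside every ball around
    0.\<close>
  define Y where "Y r \<omega> = ?T (\<lambda>j. X j r \<omega>)" for r \<omega>
  have [measurable]: "Y r \<in> borel_measurable M" for r
    unfolding Y_def
  proof (rule measurable_coordinatewise_then_product)
    show "(\<lambda>\<omega>. if j < n then X j r \<omega> else 0) \<in> borel_measurable M" for j
      by (cases "j < n") (simp_all add: X)
  qed
  have [measurable]: "?T \<in> borel_measurable ?PL"
    by (rule measurable_truncate) (rule L)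
  have [measurable]: "(\<lambda>\<omega>. h (A r \<omega>) (Y r \<omega>)) \<in> borel_measurable M" for r
  proof -
    have "(\<lambda>\<omega>. (A r \<omega>, Y r \<omega>)) \<in> borel_measurable M"
      by (intro borel_measurable_Pair) measurable
    from measurable_compose[OF this h_meas] show ?thesis by simp
  qed
  \<comment> \<open>The assumed convergence rewritten for bounded continuous functions of sequences;
    needed for \<open>h a\<close> and for a cutoff function.\<close>
  have test: "((\<lambda>r. \<integral>\<omega>. \<phi> (Y r \<omega>) \<partial>M) \<longlongrightarrow> (\<integral>y. \<phi> (?T y) \<partial>?PL)) at_top"
    if "continuous_on UNIV \<phi>" "\<And>y. \<bar>\<phi> y\<bar> \<le> C" for \<phi> :: "(nat \<Rightarrow> 'b) \<Rightarrow> real" and C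
  proof -
    have "continuous_map (product_topology (\<lambda>_. euclidean) {..<n}) euclideanreal (\<lambda>y. \<phi> (?T y))"
      using continuous_map_compose[OF continuous_map_truncate, of euclideanreal \<phi>] that(1)
      by (simp add: comp_def)
    moreover have "bounded ((\<lambda>y. \<phi> (?T y)) ` topspace (product_topology (\<lambda>_. euclidean) {..<n}))"
      using that(2) by (auto intro!: boundedI)
    ultimately have "((\<lambda>r. \<integral>\<omega>. \<phi> (?T (\<lambda>j\<in>{..<n}. X j r \<omega>)) \<partial>M) \<longlongrightarrow> (\<integral>y. \<phi> (?T y) \<partial>?PL)) at_top"
      using conv[unfolded tuple_conv_in_distr_def conv_in_distr_def, rule_format, of "\<lambda>y. \<phi> (?T y)"]
      by blast
    moreover have "?T (\<lambda>j\<in>{..<n}. X j r \<omega>) = Y r \<omega>" for r \<omega>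
      by (auto simp: Y_def)
    ultimately show ?thesis by simp
  qed

  have limit: "(\<integral>y. h a (?T y) \<partial>?PL) = (\<integral>y. f y \<partial>(\<Pi>\<^sub>M j\<in>{..<n}. distr (L j) borel (g a)))"
  proof -
    have ga: "g a \<in> borel_measurable borel"
      using continuous_on_compose2[OF g, of UNIV "\<lambda>x. (a, x)"]
      by (intro borel_measurable_continuous_onI) (simp add: continuous_on_Pair)
    then have ga': "g a \<in> borel_measurable (L j)" for j
      using measurable_cong_sets[OF L(2) refl] by blast
    \<comment> \<open>The image laws act as their own target spaces \<open>D j\<close> when the
      image of a product law is identified as a product; their sigma-algebras are Borel.\<close>
    define D where "D j = distr (L j) borel (g a)" for j
    have D: "prob_space (D j)" "sets (D j) = sets borel" for j
      using ga' by (auto simp: D_def intro: prob_space.prob_space_distr[OF L(1)])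
    have ga'': "g a \<in> measurable (L j) (D j)" for j
      using ga' measurable_cong_sets[OF refl D(2)] by blast
    have "distr ?PL (\<Pi>\<^sub>M j\<in>{..<n}. D j) (compose {..<n} (g a)) = (\<Pi>\<^sub>M j\<in>{..<n}. distr (L j) (D j) (g a))"
      by (rule distr_PiM_finite_prob_space') (use L D ga'' in auto)
    also have "\<dots> = (\<Pi>\<^sub>M j\<in>{..<n}. D j)"
      by (intro PiM_cong) (auto simp: D_def intro: distr_cong)
    finally have PD: "(\<Pi>\<^sub>M j\<in>{..<n}. D j) = distr ?PL (\<Pi>\<^sub>M j\<in>{..<n}. D j) (compose {..<n} (g a))" ..
    have F_meas: "F \<in> borel_measurable borel"
      by (rule borel_measurable_continuous_onI[OF F_cont])
    \<comment> \<open>Continuity of \<open>f\<close> refers to a topology, the claim to a product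
      sigma-algebra. Passing through sequences reconciles them, since there Borel measurability may
      be checked coordinatewise.\<close>
    have f_meas: "f \<in> borel_measurable (\<Pi>\<^sub>M j\<in>{..<n}. D j)"
    proof (subst measurable_cong)
      show "f y = F (\<lambda>j. if j < n then y j else undefined)" if "y \<in> space (\<Pi>\<^sub>M j\<in>{..<n}. D j)" for y
        unfolding F_def using that
        by (intro arg_cong[where f = f]) (auto simp: space_PiM PiE_def extensional_def restrict_def)
      show "(\<lambda>y. F (\<lambda>j. if j < n then y j else undefined)) \<in> borel_measurable (\<Pi>\<^sub>M j\<in>{..<n}. D j)"
        by (rule measurable_compose[OF measurable_truncate F_meas]) (rule D)
    qed
    have c_meas: "compose {..<n} (g a) \<in> measurable ?PL (\<Pi>\<^sub>M j\<in>{..<n}. D j)"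
      unfolding compose_def
    proof (rule measurable_restrict)
      fix j assume "j \<in> {..<n}"
      then have "(\<lambda>y. y j) \<in> measurable ?PL (L j)" by (rule measurable_component_singleton)
      then show "(\<lambda>y. g a (y j)) \<in> measurable ?PL (D j)" by (rule measurable_compose) (rule ga'')
    qed
    have "(\<integral>y. f y \<partial>(\<Pi>\<^sub>M j\<in>{..<n}. D j)) = (\<integral>y. f (compose {..<n} (g a) y) \<partial>?PL)"
      by (subst PD, rule integral_distr[OF c_meas f_meas])
    also have "(\<lambda>y. f (compose {..<n} (g a) y)) = (\<lambda>y. h a (?T y))"
      unfolding h_def F_def compose_def by (intro ext arg_cong[where f = f]) (auto simp: restrict_def)
    finally show ?thesis by (simp add: D_def)
  qed

  \<comment> \<open>Off the event that \<open>A r\<close> is far from \<open>a\<close> or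
    \<open>Y r\<close> is large, uniform continuity of \<open>h\<close> on a compact set makes the
    difference small. The first event is rare by convergence in probability, the second by
    tightness.\<close>
  have diff: "((\<lambda>r. \<integral>\<omega>. \<bar>h (A r \<omega>) (Y r \<omega>) - h a (Y r \<omega>)\<bar> \<partial>M) \<longlongrightarrow> 0) at_top"
  proof (rule tendstoI)
    fix e :: real assume "e > 0"
    \<comment> \<open>The final bound contains \<epsilon> once from uniform continuity and twice
      with factor \<open>2 * B\<close>, from the cutoff and from the bad event, so it equals
      \<open>e / 2\<close>.\<close>
    define \<epsilon> where "\<epsilon> = e / 2 / (1 + 4 * B)"
    have \<epsilon>: "\<epsilon> > 0"
      using \<open>e > 0\<close> B by (simp add: \<epsilon>_def)
    have "1 + 4 * B \<noteq> 0" using B by simp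
    then have "(1 + 4 * B) * \<epsilon> = e / 2"
      unfolding \<epsilon>_def times_divide_eq_right[of "1 + 4 * B" "e / 2"] by (rule nonzero_mult_div_cancel_left)
    with \<open>e > 0\<close> have \<epsilon>e: "(1 + 4 * B) * \<epsilon> < e" by simp
    \<comment> \<open>A continuous substitute for the indicator of large tuples: 0 where the sum of
      norms is at most \<open>K\<close>, and 1 where it is at least \<open>K + 1\<close>. Continuity
      makes it an admissible test function.\<close>
    define \<psi> where "\<psi> K x = min 1 (max 0 ((\<Sum>j<n. norm (x j)) - K))" for K :: real and x :: "nat \<Rightarrow> 'b"
    have \<psi>_cont: "continuous_on UNIV (\<psi> K)" for K
      unfolding \<psi>_def by (intro continuous_intros continuous_on_product_coordinates)
    have [measurable]: "\<psi> K \<in> borel_measurable borel" for K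
      by (rule borel_measurable_continuous_onI[OF \<psi>_cont])
    have \<psi>01: "0 \<le> \<psi> K x" "\<psi> K x \<le> 1" for K x
      by (auto simp: \<psi>_def)
    \<comment> \<open>Tightness of the limit law: the cutoff vanishes at each fixed tuple once
      \<open>K\<close> is large.\<close>
    have "((\<lambda>K. \<integral>y. \<psi> K (?T y) \<partial>?PL) \<longlongrightarrow> (\<integral>y. 0 \<partial>?PL)) at_top"
    proof (rule integral_dominated_convergence_at_top[where w = "\<lambda>_. 1"])
      show "AE y in ?PL. ((\<lambda>K. \<psi> K (?T y)) \<longlongrightarrow> 0) at_top"
      proof (rule AE_I2)
        fix y
        have "\<forall>\<^sub>F K in at_top. \<psi> K (?T y) = 0"
          using eventually_ge_at_top[of "\<Sum>j<n. norm (?T y j)"] by eventually_elim (simp add: \<psi>_def)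
        then show "((\<lambda>K. \<psi> K (?T y)) \<longlongrightarrow> 0) at_top"
          by (rule tendsto_eventually)
      qed
    qed (use \<psi>01 in auto)
    then have "\<forall>\<^sub>F K in at_top. (\<integral>y. \<psi> K (?T y) \<partial>?PL) < \<epsilon>"
      using \<epsilon> by (auto dest: order_tendstoD(2))
    then obtain K where K: "(\<integral>y. \<psi> K (?T y) \<partial>?PL) < \<epsilon>"
      by (auto simp: eventually_at_top_linorder)
    \<comment> \<open>The maximum with 0 keeps the padded coordinates in \<open>Q\<close> even if
      \<open>K + 1\<close> is negative.\<close>
    define Q where "Q = {a - 1..a + 1} \<times> {x :: nat \<Rightarrow> 'b. \<forall>j. norm (x j) \<le> max 0 (K + 1)}"
    have "uniformly_continuous_on Q (\<lambda>p. h (fst p) (snd p))"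
      unfolding Q_def by (intro compact_uniformly_continuous compact_Times compact_Icc compact_bounded_functions
          continuous_on_subset[OF h_cont]) auto
    then have "\<exists>\<delta>>0. \<forall>q\<in>Q. \<forall>p\<in>Q. dist p q < \<delta> \<longrightarrow> dist (h (fst p) (snd p)) (h (fst q) (snd q)) < \<epsilon>"
      unfolding uniformly_continuous_on_def using \<epsilon> by simp
    then obtain \<delta> where \<delta>: "\<delta> > 0" "\<And>p q. p \<in> Q \<Longrightarrow> q \<in> Q \<Longrightarrow> dist p q < \<delta> \<Longrightarrow>
        \<bar>h (fst p) (snd p) - h (fst q) (snd q)\<bar> < \<epsilon>"
      unfolding dist_real_def by blast
    \<comment> \<open>The bound 1 ensures that \<open>A r \<omega>\<close> lies in the interval that
      defines \<open>Q\<close>.\<close>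
    define \<delta>' where "\<delta>' = min \<delta> 1"
    have \<delta>': "\<delta>' > 0" using \<delta> by (simp add: \<delta>'_def)
    let ?bad = "\<lambda>r. {\<omega> \<in> space M. \<delta>' \<le> \<bar>A r \<omega> - a\<bar>}"
    have bad_sets [measurable]: "?bad r \<in> sets M" for r by measurable
    have pointwise: "\<bar>h (A r \<omega>) (Y r \<omega>) - h a (Y r \<omega>)\<bar>
        \<le> \<epsilon> + 2 * B * \<psi> K (Y r \<omega>) + 2 * B * indicator (?bad r) \<omega>" if "\<omega> \<in> space M" for r \<omega>
    proof -
      have le2B: "\<bar>h (A r \<omega>) (Y r \<omega>) - h a (Y r \<omega>)\<bar> \<le> 2 * B"
        using h_le[of "A r \<omega>" "Y r \<omega>"] h_le[of a "Y r \<omega>"] by linarith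
      have nn: "0 \<le> 2 * B * \<psi> K (Y r \<omega>)" "0 \<le> 2 * B * indicator (?bad r) \<omega>"
        using B \<psi>01 by simp_all
      show ?thesis
      proof (cases "\<delta>' \<le> \<bar>A r \<omega> - a\<bar>")
        case True
        then have "2 * B * indicator (?bad r) \<omega> = 2 * B" using that by simp
        then show ?thesis using le2B nn(1) \<epsilon> by linarith
      next
        case small: False
        show ?thesis
        proof (cases "K + 1 \<le> (\<Sum>j<n. norm (Y r \<omega> j))")
          case True
          then have "2 * B * \<psi> K (Y r \<omega>) = 2 * B" by (simp add: \<psi>_def)
          then show ?thesis using le2B nn(2) \<epsilon> by linarith
        next
          case False
          have "norm (Y r \<omega> j) \<le> max 0 (K + 1)" for j
          proof (cases "j < n")
            case True
            then have "norm (Y r \<omega> j) \<le> (\<Sum>j<n. norm (Y r \<omega> j))"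
              by (intro member_le_sum) auto
            with False show ?thesis by simp
          qed (simp add: Y_def)
          then have "(A r \<omega>, Y r \<omega>) \<in> Q" "(a, Y r \<omega>) \<in> Q"
            using small by (auto simp: \<delta>'_def Q_def)
          moreover have "dist (A r \<omega>, Y r \<omega>) (a, Y r \<omega>) < \<delta>"
            using small by (simp add: dist_Pair_Pair dist_real_def \<delta>'_def)
          ultimately have "\<bar>h (A r \<omega>) (Y r \<omega>) - h a (Y r \<omega>)\<bar> < \<epsilon>"
            using \<delta>(2)[of "(A r \<omega>, Y r \<omega>)" "(a, Y r \<omega>)"] by simp
          then show ?thesis using nn by simp
        qed
      qed
    qed
    have i\<psi>: "integrable M (\<lambda>\<omega>. \<psi> K (Y r \<omega>))" for r
      by (rule M.integrable_const_bound[of _ 1]) (use \<psi>01 in auto)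
    have ibad: "integrable M (indicator (?bad r) :: 'w \<Rightarrow> real)" for r
      by (rule integrable_real_indicator) (auto simp: less_top[symmetric])
    have bound: "(\<integral>\<omega>. \<bar>h (A r \<omega>) (Y r \<omega>) - h a (Y r \<omega>)\<bar> \<partial>M)
        \<le> \<epsilon> + 2 * B * (\<integral>\<omega>. \<psi> K (Y r \<omega>) \<partial>M) + 2 * B * measure M (?bad r)" for r
    proof -
      have "(\<integral>\<omega>. \<bar>h (A r \<omega>) (Y r \<omega>) - h a (Y r \<omega>)\<bar> \<partial>M)
          \<le> (\<integral>\<omega>. \<epsilon> + 2 * B * \<psi> K (Y r \<omega>) + 2 * B * indicator (?bad r) \<omega> \<partial>M)"
      proof (rule integral_mono)
        show "integrable M (\<lambda>\<omega>. \<bar>h (A r \<omega>) (Y r \<omega>) - h a (Y r \<omega>)\<bar>)"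
        proof (rule M.integrable_const_bound[of _ "2 * B"])
          show "AE \<omega> in M. norm \<bar>h (A r \<omega>) (Y r \<omega>) - h a (Y r \<omega>)\<bar> \<le> 2 * B"
          proof (rule AE_I2)
            fix \<omega>
            show "norm \<bar>h (A r \<omega>) (Y r \<omega>) - h a (Y r \<omega>)\<bar> \<le> 2 * B"
              using h_le[of "A r \<omega>" "Y r \<omega>"] h_le[of a "Y r \<omega>"] by simp
          qed
        qed measurable
        show "integrable M (\<lambda>\<omega>. \<epsilon> + 2 * B * \<psi> K (Y r \<omega>) + 2 * B * indicator (?bad r) \<omega>)"
          by (intro Bochner_Integration.integrable_add integrable_mult_right i\<psi> ibad M.integrable_const)
      qed (rule pointwise)
      also have "\<dots> = \<epsilon> + 2 * B * (\<integral>\<omega>. \<psi> K (Y r \<omega>) \<partial>M) + 2 * B * measure M (?bad r)"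
        using i\<psi>[of r] ibad[of r] by (simp add: M.prob_space)
      finally show ?thesis .
    qed
    \<comment> \<open>Weak convergence hands the smallness of the cutoff under the limit law over to
      \<open>Y r\<close> for large \<open>r\<close>.\<close>
    have "\<forall>\<^sub>F r in at_top. (\<integral>\<omega>. \<psi> K (Y r \<omega>) \<partial>M) < \<epsilon>"
      using \<psi>01 by (intro order_tendstoD(2)[OF test[OF \<psi>_cont, of K 1] K]) simp
    moreover have "\<forall>\<^sub>F r in at_top. measure M (?bad r) < \<epsilon>"
      using prob_conv[OF \<delta>'] \<epsilon> by (rule order_tendstoD(2))
    ultimately show "\<forall>\<^sub>F r in at_top. dist (\<integral>\<omega>. \<bar>h (A r \<omega>) (Y r \<omega>) - h a (Y r \<omega>)\<bar> \<partial>M) 0 < e"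
    proof eventually_elim
      case (elim r)
      have "2 * B * (\<integral>\<omega>. \<psi> K (Y r \<omega>) \<partial>M) \<le> 2 * B * \<epsilon>" "2 * B * measure M (?bad r) \<le> 2 * B * \<epsilon>"
        using elim B by (auto intro!: mult_left_mono)
      then have "(\<integral>\<omega>. \<bar>h (A r \<omega>) (Y r \<omega>) - h a (Y r \<omega>)\<bar> \<partial>M) < e"
        using bound[of r] \<epsilon>e by (simp add: algebra_simps)
      moreover have "0 \<le> (\<integral>\<omega>. \<bar>h (A r \<omega>) (Y r \<omega>) - h a (Y r \<omega>)\<bar> \<partial>M)"
        by simp
      ultimately show ?case by simp
    qed
  qed

  have "((\<lambda>r. \<integral>\<omega>. h (A r \<omega>) (Y r \<omega>) - h a (Y r \<omega>) \<partial>M) \<longlongrightarrow> 0) at_top"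
    by (rule Lim_null_comparison[OF _ diff]) (auto intro!: always_eventually integral_abs_bound)
  then have "((\<lambda>r. (\<integral>\<omega>. h (A r \<omega>) (Y r \<omega>) - h a (Y r \<omega>) \<partial>M) + (\<integral>\<omega>. h a (Y r \<omega>) \<partial>M)) \<longlongrightarrow>
      0 + (\<integral>y. h a (?T y) \<partial>?PL)) at_top"
    by (rule tendsto_add) (rule test[OF ha_cont h_le])
  moreover have "(\<integral>\<omega>. h (A r \<omega>) (Y r \<omega>) - h a (Y r \<omega>) \<partial>M) + (\<integral>\<omega>. h a (Y r \<omega>) \<partial>M)
      = (\<integral>\<omega>. f (\<lambda>j\<in>{..<n}. g (A r \<omega>) (X j r \<omega>)) \<partial>M)" for r
  proof -
    have "integrable M (\<lambda>\<omega>. h (A r \<omega>) (Y r \<omega>))" "integrable M (\<lambda>\<omega>. h a (Y r \<omega>))"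
      using h_le by (auto intro!: M.integrable_const_bound[of _ B])
    moreover have "h (A r \<omega>) (Y r \<omega>) = f (\<lambda>j\<in>{..<n}. g (A r \<omega>) (X j r \<omega>))" for \<omega>
      unfolding h_def F_def by (intro arg_cong[where f = f]) (auto simp: Y_def restrict_def)
    ultimately show ?thesis by simp
  qed
  ultimately show "((\<lambda>r. \<integral>\<omega>. f (\<lambda>j\<in>{..<n}. g (A r \<omega>) (X j r \<omega>)) \<partial>M) \<longlongrightarrow>
      (\<integral>y. f y \<partial>(\<Pi>\<^sub>M j\<in>{..<n}. distr (L j) borel (g a)))) at_top"
    by (simp add: limit)
qed

section \<open>Squared modulus of a complex Gaussian variable\<close>

text \<open>The disc of radius sqrt(t/c) has area pi t/c, so the image of planar Lebesgue measure
  has constant density on the half-line. Both measures are finite on the sets \<open>{..t}\<close>,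
  which determine them.\<close>

lemma distr_scaled_sum_squares:
  fixes c :: real
  assumes c: "c > 0"
  shows "distr (lborel \<Otimes>\<^sub>M lborel) borel (\<lambda>p. c * ((fst p)\<^sup>2 + (snd p)\<^sup>2))
    = density lborel (\<lambda>t. ennreal (pi / c) * indicator {0..} t)" (is "?P = ?Q")
proof (rule measure_eqI_generator_eq)
  let ?E = "range (\<lambda>t::real. {..t})"
  have eq: "emeasure ?P {..t} = ennreal (pi / c * max 0 t) \<and> emeasure ?Q {..t} = ennreal (pi / c * max 0 t)" for t
  proof
    have "emeasure ?P {..t} = emeasure (lborel :: (real \<times> real) measure) {p. c * ((fst p)\<^sup>2 + (snd p)\<^sup>2) \<le> t}"
      by (subst emeasure_distr) (auto simp: lborel_prod[symmetric] space_pair_measure vimage_def)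
    also have "{p. c * ((fst p)\<^sup>2 + (snd p)\<^sup>2) \<le> t} = (if t < 0 then {} else cball (0 :: real \<times> real) (sqrt (t / c)))"
    proof (cases "t < 0")
      case True
      have "0 \<le> c * ((fst p)\<^sup>2 + (snd p)\<^sup>2)" for p :: "real \<times> real"
        using c by simp
      with True show ?thesis by (auto simp: not_le intro: less_le_trans)
    next
      case False
      have "norm p \<le> sqrt (t / c) \<longleftrightarrow> c * ((fst p)\<^sup>2 + (snd p)\<^sup>2) \<le> t" for p :: "real \<times> real"
        using c by (simp add: norm_prod_def pos_le_divide_eq mult.commute)
      with False show ?thesis by auto
    qed
    also have "emeasure lborel \<dots> = ennreal (pi / c * max 0 t)"
      using c by (auto simp: emeasure_cball unit_ball_vol_2 max_def)
    finally show "emeasure ?P {..t} = ennreal (pi / c * max 0 t)" .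
    have "emeasure ?Q {..t} = (\<integral>\<^sup>+s. ennreal (pi / c) * indicator {0..t} s \<partial>lborel)"
      by (subst emeasure_density) (auto intro!: nn_integral_cong split: split_indicator)
    also have "\<dots> = ennreal (pi / c) * ennreal (max 0 t)"
      by (cases "t \<ge> 0") (auto simp: nn_integral_cmult_indicator max_def)
    also have "\<dots> = ennreal (pi / c * max 0 t)"
      using c by (intro ennreal_mult[symmetric]) auto
    finally show "emeasure ?Q {..t} = ennreal (pi / c * max 0 t)" .
  qed
  show "emeasure ?P X = emeasure ?Q X" if "X \<in> ?E" for X
    using that eq by auto
  show "Int_stable ?E"
    by (auto simp: Int_stable_def)
  show "sets ?P = sigma_sets UNIV ?E" "sets ?Q = sigma_sets UNIV ?E"
    by (simp_all add: borel_eq_atMost)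
  show "range (\<lambda>i::nat. {..real i}) \<subseteq> ?E" by auto
  show "(\<Union>i::nat. {..real i}) = UNIV"
    using real_arch_simple by auto
  show "emeasure ?P {..real i} \<noteq> \<infinity>" for i
    using eq by simp
qed simp

lemma Complex_measurable [measurable]:
  "(\<lambda>(a, b). Complex a b) \<in> borel_measurable (borel \<Otimes>\<^sub>M borel)"
  unfolding borel_prod case_prod_beta Complex_eq
  by (intro borel_measurable_continuous_onI continuous_intros)

text \<open>The joint Gaussian density depends on the point only through the scaled squared norm, so
  it can be pulled through the image and multiplied with the constant density found for Lebesgue
  measure.\<close>

lemma distr_complex_gaussian:
  assumes v: "v > 0" and c: "c > 0"
  shows "distr (complex_gaussian v) borel (\<lambda>z. c * (cmod z)\<^sup>2)
    = density lborel (exponential_density (1 / (2 * v * c)))"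
proof -
  let ?n = "\<lambda>x. ennreal (normal_density 0 (sqrt v) x)"
  let ?\<rho> = "\<lambda>p :: real \<times> real. c * ((fst p)\<^sup>2 + (snd p)\<^sup>2)"
  let ?f = "\<lambda>t. ennreal (1 / (2 * pi * v) * exp (- t / (2 * v * c)))"
  interpret prob_space "density lborel (normal_density 0 (sqrt v))"
    using v by (intro prob_space_normal_density) simp
  have "complex_gaussian v = distr (density (lborel \<Otimes>\<^sub>M lborel) (\<lambda>(x, y). ?n x * ?n y)) borel (\<lambda>(a, b). Complex a b)"
    unfolding complex_gaussian_def centered_gaussian_def using v
    by (simp add: pair_measure_density sigma_finite_measure_axioms sigma_finite_lborel)
  then have "distr (complex_gaussian v) borel (\<lambda>z. c * (cmod z)\<^sup>2)
      = distr (density (lborel \<Otimes>\<^sub>M lborel) (\<lambda>(x, y). ?n x * ?n y)) borel ((\<lambda>z. c * (cmod z)\<^sup>2) \<circ> (\<lambda>(a, b). Complex a b))"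
    by (simp add: distr_distr)
  also have "(\<lambda>z. c * (cmod z)\<^sup>2) \<circ> (\<lambda>(a, b). Complex a b) = ?\<rho>"
    by (auto simp: cmod_def)
  also have "(\<lambda>(x, y). ?n x * ?n y) = (\<lambda>p. ?f (?\<rho> p))"
  proof
    fix p :: "real \<times> real"
    obtain x y where p: "p = (x, y)" by (cases p)
    have "normal_density 0 (sqrt v) x * normal_density 0 (sqrt v) y
        = 1 / (2 * pi * v) * exp (- (x\<^sup>2 / (2 * v)) - y\<^sup>2 / (2 * v))"
      using v by (simp add: normal_density_def real_sqrt_mult[symmetric] exp_add[symmetric] power2_eq_square
          real_sqrt_mult_self)
    also have "- (x\<^sup>2 / (2 * v)) - y\<^sup>2 / (2 * v) = - ?\<rho> p / (2 * v * c)"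
      using v c by (simp add: p field_simps)
    finally show "(case p of (x, y) \<Rightarrow> ?n x * ?n y) = ?f (?\<rho> p)"
      by (simp add: p ennreal_mult[symmetric])
  qed
  also have "distr (density (lborel \<Otimes>\<^sub>M lborel) (\<lambda>p. ?f (?\<rho> p))) borel ?\<rho>
      = density (distr (lborel \<Otimes>\<^sub>M lborel) borel ?\<rho>) ?f"
    by (rule density_distr[symmetric]) measurable
  also have "\<dots> = density lborel (\<lambda>t. ennreal (pi / c) * indicator {0..} t * ?f t)"
    unfolding distr_scaled_sum_squares[OF c] by (rule density_density_eq) measurable
  \<comment> \<open>The constants combine as (pi / c) / (2 pi v) = 1 / (2 v c), the rate of the
    exponential law.\<close>
  also have "\<dots> = density lborel (exponential_density (1 / (2 * v * c)))"
    using v c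
    by (intro density_cong) (auto simp: exponential_density_def ennreal_mult[symmetric] field_simps split: split_indicator)
  finally show ?thesis .
qed

lemma prob_space_complex_gaussian: "prob_space (complex_gaussian v)"
proof -
  have c: "prob_space (centered_gaussian v)" "sets (centered_gaussian v) = sets borel"
    by (auto simp: centered_gaussian_def prob_space_normal_density prob_space_return)
  interpret pair_prob_space "centered_gaussian v" "centered_gaussian v"
    using c(1) by (simp add: pair_prob_space_def pair_sigma_finite_def prob_space_imp_sigma_finite)
  note [measurable_cong] = c(2)
  show ?thesis
    unfolding complex_gaussian_def by (rule prob_space_distr) measurable
qed

lemma sets_complex_gaussian [measurable_cong]: "sets (complex_gaussian v) = sets borel"
  by (simp add: complex_gaussian_def)

text \<open>With variance \<open>\<gamma> * s / 2\<close> per component and factor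
  \<open>1 / \<gamma>\<close>, the mean 2 v c becomes \<open>s\<close>. For nonpositive
  \<open>s\<close> both sides are the point mass at 0.\<close>

lemma distr_complex_gaussian_exponential_law:
  assumes "\<gamma> > 0"
  shows "distr (complex_gaussian (\<gamma> * s / 2)) borel (\<lambda>z. 1 / \<gamma> * (cmod z)\<^sup>2) = exponential_law s"
proof (cases "s > 0")
  case True
  then show ?thesis
    using distr_complex_gaussian[of "\<gamma> * s / 2" "1 / \<gamma>"] assms
    by (simp add: exponential_law_def)
next
  case False
  then have "\<not> \<gamma> * s / 2 > 0" using assms by (simp add: zero_less_mult_iff)
  moreover have "(return borel 0 \<Otimes>\<^sub>M return borel 0) = return (borel \<Otimes>\<^sub>M borel) (0 :: real, 0 :: real)"
  proof (rule pair_measure_eqI)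
    interpret prob_space "return borel (0 :: real)" by (rule prob_space_return) simp
    show "sigma_finite_measure (return borel (0 :: real))" "sigma_finite_measure (return borel (0 :: real))"
      by unfold_locales
  qed (auto simp: indicator_def)
  ultimately have "complex_gaussian (\<gamma> * s / 2) = return borel 0"
    by (simp add: complex_gaussian_def centered_gaussian_def distr_return space_pair_measure zero_complex.code)
  then show ?thesis
    using False by (simp add: exponential_law_def distr_return)
qed

section \<open>Scattering intensity\<close>

text \<open>A nonnegative sum is an integral over the random set, finite because \<open>W\<close> is
  bounded; the general case follows by splitting into positive and negative parts.\<close>

lemma sum_measurable_real:
  fixes g :: "real ^ 'd \<Rightarrow> real"
  assumes [measurable]: "g \<in> borel_measurable borel" "W \<in> sets borel" and W: "bounded W"
  shows "(\<lambda>\<phi>. \<Sum>x\<in>\<phi> \<inter> W. g x) \<in> borel_measurable config_space"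
proof -
  have nonneg: "(\<lambda>\<phi>. \<Sum>x\<in>\<phi> \<inter> W. u x) \<in> borel_measurable config_space"
    if [measurable]: "u \<in> borel_measurable borel" and u: "\<And>x. 0 \<le> u x" for u :: "real ^ 'd \<Rightarrow> real"
  proof (subst measurable_cong)
    have "(\<lambda>\<phi>. \<integral>\<^sup>+x. ennreal (u x) * indicator W x \<partial>count_space \<phi>) \<in> borel_measurable config_space"
      by (rule nn_integral_random_set_measurable[where N = borel])
        (use points_in_measurable[unfolded points_in_def] in auto)
    then show "(\<lambda>\<phi>. enn2real (\<integral>\<^sup>+x. ennreal (u x) * indicator W x \<partial>count_space \<phi>)) \<in> borel_measurable config_space"
      by measurable
    fix \<phi> :: "(real ^ 'd) set" assume "\<phi> \<in> space config_space"
    then have fin: "finite (\<phi> \<inter> W)"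
      using W by (simp add: space_config_space loc_finite_def)
    have "(\<integral>\<^sup>+x. ennreal (u x) * indicator W x \<partial>count_space \<phi>) = (\<integral>\<^sup>+x. ennreal (u x) \<partial>count_space (\<phi> \<inter> W))"
      by (subst (1 2) nn_integral_count_space_indicator) (auto intro!: nn_integral_cong split: split_indicator)
    also have "\<dots> = ennreal (\<Sum>x\<in>\<phi> \<inter> W. u x)"
      using fin u by (simp add: nn_integral_count_space_finite sum_ennreal)
    finally show "(\<Sum>x\<in>\<phi> \<inter> W. u x) = enn2real (\<integral>\<^sup>+x. ennreal (u x) * indicator W x \<partial>count_space \<phi>)"
      using u by (simp add: sum_nonneg)
  qed
  have "(\<lambda>\<phi>. (\<Sum>x\<in>\<phi> \<inter> W. max 0 (g x)) - (\<Sum>x\<in>\<phi> \<inter> W. max 0 (- g x))) \<in> borel_measurable config_space"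
    by (intro borel_measurable_diff nonneg) auto
  moreover have "(\<Sum>x\<in>\<phi> \<inter> W. max 0 (g x)) - (\<Sum>x\<in>\<phi> \<inter> W. max 0 (- g x)) = (\<Sum>x\<in>\<phi> \<inter> W. g x)" for \<phi>
    by (simp add: sum_subtractf[symmetric]) (intro sum.cong, auto simp: max_def)
  ultimately show ?thesis by simp
qed

lemma T_stat_measurable: "(\<lambda>\<phi>. T_stat \<gamma> r \<phi> k) \<in> borel_measurable config_space"
proof -
  have e: "(\<lambda>x. exp (- \<i> * complex_of_real (k \<bullet> x))) \<in> borel_measurable borel"
    by (intro borel_measurable_continuous_onI continuous_intros)
  have [measurable]: "(\<lambda>\<phi>. \<Sum>x\<in>\<phi> \<inter> window r. exp (- \<i> * complex_of_real (k \<bullet> x))) \<in> borel_measurable config_space"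
    unfolding borel_measurable_complex_iff Re_sum Im_sum
    using e by (intro conjI sum_measurable_real window_sets bounded_window) measurable
  show ?thesis
    unfolding T_stat_def by measurable
qed

text \<open>Multiplying T_r by r^(d/2) turns its centering term \<gamma> r^(d/2) into \<gamma> r^d,
  the one in the scattering intensity. For a window without points both sides are 0, by the
  convention on division by 0.\<close>

lemma scattering_intensity_eq_T_stat:
  fixes k :: "real ^ 'd"
  assumes "r > 0"
  shows "scattering_intensity \<gamma> r \<phi> k
    = r ^ CARD('d) / real (card (\<phi> \<inter> window r)) * (cmod (T_stat \<gamma> r \<phi> k))\<^sup>2"
proof -
  define s where "s = r powr (real CARD('d) / 2)"
  have s: "s > 0" using assms by (simp add: s_def)
  have ss: "s * s = r ^ CARD('d)"
    using assms by (simp add: s_def powr_add[symmetric] powr_realpow)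
  define S where "S = (\<Sum>x\<in>\<phi> \<inter> window r. exp (- \<i> * complex_of_real (k \<bullet> x)))"
  define c where "c = (if k = 0 then complex_of_real (\<gamma> * r ^ CARD('d)) else 0)"
  have "T_stat \<gamma> r \<phi> k = (S - c) / of_real s"
    using s unfolding T_stat_def S_def[symmetric] s_def[symmetric] c_def ss[symmetric]
    by (simp add: field_simps)
  then have "(cmod (T_stat \<gamma> r \<phi> k))\<^sup>2 = (cmod (S - c))\<^sup>2 / r ^ CARD('d)"
    using s by (simp add: norm_divide power_divide power2_eq_square[of s] ss)
  then show ?thesis
    using assms unfolding scattering_intensity_def S_def[symmetric] c_def[symmetric] by simp
qed

text \<open>Needed because the link between scattering intensity and \<open>T_stat\<close> is
  available for positive \<open>r\<close> only.\<close>

lemma tuple_conv_in_distr_cong: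
  assumes "\<forall>\<^sub>F r in at_top. \<forall>j<n. X j r = Y j r"
  shows "tuple_conv_in_distr M n X L \<longleftrightarrow> tuple_conv_in_distr M n Y L"
proof -
  have "\<forall>\<^sub>F r in at_top. (\<integral>\<omega>. f (\<lambda>j\<in>{..<n}. X j r \<omega>) \<partial>M) = (\<integral>\<omega>. f (\<lambda>j\<in>{..<n}. Y j r \<omega>) \<partial>M)" for f :: "_ \<Rightarrow> real"
    using assms
  proof eventually_elim
    case (elim r)
    then have "(\<lambda>j\<in>{..<n}. X j r \<omega>) = (\<lambda>j\<in>{..<n}. Y j r \<omega>)" for \<omega> by auto
    then show ?case by simp
  qed
  from tendsto_cong[OF this] show ?thesis
    by (simp add: tuple_conv_in_distr_def conv_in_distr_def)
qed

theorem proposition5p2: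
  fixes M :: "'w measure"
    and \<eta> :: "'w \<Rightarrow> (real ^ 'd) set"
    and \<gamma> :: real
    and n :: nat
    and k :: "nat \<Rightarrow> real ^ 'd"
    and N :: "nat \<Rightarrow> real \<Rightarrow> int ^ 'd"
  assumes "point_process M \<eta>"
    and "stationary M \<eta>"
    and "ergodic M \<eta>"
    and "loc_square_integrable M \<eta>"
    and "\<gamma> > 0"
    and "intensity M \<eta> = ennreal \<gamma>"
    and "\<exists>p>0. (\<integral>\<^sup>+x. ennreal (1 + norm x powr p) \<partial>total_variation (beta2 \<gamma> M \<eta>)) < \<infinity>"
    and "good \<gamma> M \<eta>"
    and "\<forall>j<n. k j \<noteq> 0"
    and "\<forall>i<n. \<forall>j<n. i \<noteq> j \<longrightarrow> {k i, - k i} \<inter> {k j, - k j} = {}"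
    and "\<forall>j<n. ((\<lambda>r. lattice_freq r (N j r)) \<longlongrightarrow> k j) at_top"
  shows "tuple_conv_in_distr M n
           (\<lambda>j r \<omega>. scattering_intensity \<gamma> r (\<eta> \<omega>) (lattice_freq r (N j r)))
           (\<lambda>j. exponential_law (Re (structure_factor \<gamma> M \<eta> (k j))))"
proof -
  interpret stationary_point_process M \<eta> \<gamma>
    using assms by unfold_locales auto
  let ?S = "\<lambda>j. Re (structure_factor \<gamma> M \<eta> (k j))"
  let ?T = "\<lambda>j r \<omega>. T_stat \<gamma> r (\<eta> \<omega>) (lattice_freq r (N j r))"
  let ?A = "\<lambda>r \<omega>. r ^ CARD('d) / real (card (\<eta> \<omega> \<inter> window r))"
  \<comment> \<open>The weight 1 + |x|^p is at least 1, so the moment condition bounds the total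
    mass of the total variation and hence that of its upper part.\<close>
  have uv: "emeasure (upper_variation (beta2 \<gamma> M \<eta>)) UNIV < \<infinity>"
  proof -
    let ?tv = "total_variation (beta2 \<gamma> M \<eta>)"
    obtain p where p: "(\<integral>\<^sup>+x. ennreal (1 + norm x powr p) \<partial>?tv) < \<infinity>"
      using assms(7) by blast
    have "emeasure (upper_variation (beta2 \<gamma> M \<eta>)) UNIV \<le> emeasure ?tv UNIV"
      by (simp add: emeasure_total_variation)
    also have "\<dots> = (\<integral>\<^sup>+x. 1 \<partial>?tv)"
      using sets_eq_imp_space_eq[OF sets_total_variation[of "beta2 \<gamma> M \<eta>"]] by simp
    also have "\<dots> \<le> (\<integral>\<^sup>+x. ennreal (1 + norm x powr p) \<partial>?tv)"
      by (intro nn_integral_mono) (simp add: ennreal_ge_1)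
    finally show ?thesis using p by (rule le_less_trans)
  qed
  have "tuple_conv_in_distr M n ?T (\<lambda>j. complex_gaussian (\<gamma> * ?S j / 2))"
    using assms(8-11) by (simp add: good_def admissible_def)
  moreover have "?T j r \<in> borel_measurable M" for j r
    by (rule measurable_compose[OF \<eta>_measurable T_stat_measurable])
  moreover have A_meas: "?A r \<in> borel_measurable M" for r
    using card_measurable[OF window_sets bounded_window, of r] by measurable
  moreover have "((\<lambda>r. measure M {\<omega> \<in> space M. \<epsilon> \<le> \<bar>?A r \<omega> - 1 / \<gamma>\<bar>}) \<longlongrightarrow> 0) at_top" if "\<epsilon> > 0" for \<epsilon>
  proof -
    \<comment> \<open>The factor \<open>?A r\<close> is the reciprocal of the empirical intensity.
      By continuity of inversion at the positive number \<gamma>, a deviation of \<open>?A r\<close>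
      by \<epsilon> forces one of the empirical intensity by \<delta>.\<close>
    have "isCont inverse \<gamma>" using assms(5) by (intro continuous_intros) auto
    then obtain \<delta> where \<delta>: "\<delta> > 0" "\<And>x. \<bar>x - \<gamma>\<bar> < \<delta> \<Longrightarrow> \<bar>inverse x - inverse \<gamma>\<bar> < \<epsilon>"
      using \<open>\<epsilon> > 0\<close> unfolding continuous_at_eps_delta dist_real_def by blast
    let ?D = "\<lambda>r \<omega>. real (card (\<eta> \<omega> \<inter> window r)) / r ^ CARD('d)"
    have D_meas: "?D r \<in> borel_measurable M" for r
      using card_measurable[OF window_sets bounded_window, of r] by measurable
    have "measure M {\<omega> \<in> space M. \<epsilon> \<le> \<bar>?A r \<omega> - 1 / \<gamma>\<bar>} \<le> measure M {\<omega> \<in> space M. \<delta> \<le> \<bar>?D r \<omega> - \<gamma>\<bar>}" for r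
    proof (rule finite_measure_mono)
      \<comment> \<open>Also true for an empty window, where division by 0 makes both sides
        0.\<close>
      have "inverse (?D r \<omega>) = ?A r \<omega>" for \<omega> by simp
      then show "{\<omega> \<in> space M. \<epsilon> \<le> \<bar>?A r \<omega> - 1 / \<gamma>\<bar>} \<subseteq> {\<omega> \<in> space M. \<delta> \<le> \<bar>?D r \<omega> - \<gamma>\<bar>}"
        using \<delta>(2)[of "?D r _"] by (force simp: inverse_eq_divide not_le[symmetric])
    qed (use D_meas in measurable)
    then show ?thesis
      by (intro Lim_null_comparison[OF _ density_tendsto_intensity[OF uv \<delta>(1)]]) auto
  qed
  moreover have "continuous_on UNIV (\<lambda>p. fst p * (cmod (snd p))\<^sup>2 :: real)"
    by (intro continuous_intros)
  ultimately have "tuple_conv_in_distr M n (\<lambda>j r \<omega>. ?A r \<omega> * (cmod (?T j r \<omega>))\<^sup>2)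
      (\<lambda>j. distr (complex_gaussian (\<gamma> * ?S j / 2)) borel (\<lambda>z. 1 / \<gamma> * (cmod z)\<^sup>2))"
    by (intro tuple_conv_in_distr_slutsky[where A = ?A and a = "1 / \<gamma>" and g = "\<lambda>s z. s * (cmod z)\<^sup>2"])
      (auto simp: prob_space_axioms prob_space_complex_gaussian sets_complex_gaussian)
  moreover have "\<forall>\<^sub>F r in at_top. \<forall>j<n. (\<lambda>\<omega>. ?A r \<omega> * (cmod (?T j r \<omega>))\<^sup>2)
      = (\<lambda>\<omega>. scattering_intensity \<gamma> r (\<eta> \<omega>) (lattice_freq r (N j r)))"
    using eventually_gt_at_top[of 0] by eventually_elim (simp add: scattering_intensity_eq_T_stat)
  ultimately show ?thesis
    unfolding distr_complex_gaussian_exponential_law[OF assms(5)] by (subst (asm) tuple_conv_in_distr_cong)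
qed

end
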